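(* Let $p$ be a prime and let $S \subseteq \mathbb{N}_0$ be a union of finitely many arithmetic progressions together with finitely many $p$-sets. Then there exist $k \in \mathbb{N}$, an endomorphism $\Phi$ of the split torus $X = \mathbb{G}_m^k$ over $K = \overline{\mathbb{F}_p}(t)$, a point $\alpha \in X(K)$ and a closed subvariety $V \subseteq X$ defined over $K$ such that $\{ n \in \mathbb{N}_0 : \Phi^n(\alpha) \in V(K) \} = S$.
   Context: $\mathbb{N}$ denotes the positive integers and $\mathbb{N}_0 = \mathbb{N} \cup \{0\}$. An arithmetic progression in $\mathbb{N}_0$ is a set $\{a + bt : t \in \mathbb{N}_0\}$ with $a, b \in \mathbb{N}_0$. For $m \in \mathbb{N}$, $c_1,\dots,c_m \in \mathbb{Q}\setminus\{0\}$, $k_1,\dots,k_m \in \mathbb{N}_0$ and a power $q$ of $p$, set $B(q; c_1,\dots,c_m; k_1,\dots,k_m) = \{ \sum_{j=1}^m c_j q^{k_j n_j} : n_j \in \mathbb{N}_0 \text{ for each } j\}$. A $p$-set is a subset of $\mathbb{N}_0$ of the form $B(p; c_1,\dots,c_m; k_1,\dots,k_m)$ for some such $m$, $c_j$, $k_j$. A variety is not assumed irreducible; an endomorphism of $X$ means a morphism $X \to X$ defined over $K$. *)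

theory Defs
  imports "HOL-Computational_Algebra.Computational_Algebra"
begin

definition arith_prog :: "nat set \<Rightarrow> bool" where
  "arith_prog A \<longleftrightarrow> (\<exists>a b. A = {a + b * t | t. True})"

definition Bset :: "nat \<Rightarrow> nat \<Rightarrow> (nat \<Rightarrow> rat) \<Rightarrow> (nat \<Rightarrow> nat) \<Rightarrow> rat set" where
  "Bset q m c kk = {(\<Sum>j<m. c j * of_nat q ^ (kk j * n j)) | n. True}"

definition p_set :: "nat \<Rightarrow> nat set \<Rightarrow> bool" where
  "p_set p A \<longleftrightarrow> (\<exists>m c kk. m \<ge> 1 \<and> (\<forall>j<m. c j \<noteq> 0) \<and>
      (of_nat ` A :: rat set) = Bset p m c kk)"

definition torus :: "nat \<Rightarrow> (nat \<Rightarrow> 'a::field) set" where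
  "torus k = {x. (\<forall>i<k. x i \<noteq> 0) \<and> (\<forall>i\<ge>k. x i = 1)}"

text \<open>Laurent polynomials in k variables over K (the coordinate ring K[x_1^{+-1},...,x_k^{+-1}]
  of G_m^k): finitely supported coefficient functions on exponent vectors in Z^k.\<close>
definition laurent :: "nat \<Rightarrow> ((nat \<Rightarrow> int) \<Rightarrow> 'a::field) \<Rightarrow> bool" where
  "laurent k f \<longleftrightarrow> finite {e. f e \<noteq> 0} \<and> (\<forall>e. f e \<noteq> 0 \<longrightarrow> (\<forall>i\<ge>k. e i = 0))"

definition leval :: "nat \<Rightarrow> ((nat \<Rightarrow> int) \<Rightarrow> 'a::field) \<Rightarrow> (nat \<Rightarrow> 'a) \<Rightarrow> 'a" where
  "leval k f x = (\<Sum>e\<in>{e. f e \<noteq> 0}. f e * (\<Prod>i<k. x i powi e i))"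

text \<open>An endomorphism of G_m^k over K: given by k regular functions which are units of the
  coordinate ring K[x^{+-1}] (i.e. morphisms G_m^k -> G_m).\<close>
definition torus_endo :: "nat \<Rightarrow> ((nat \<Rightarrow> 'a::field) \<Rightarrow> (nat \<Rightarrow> 'a)) \<Rightarrow> bool" where
  "torus_endo k \<Phi> \<longleftrightarrow> (\<exists>\<phi>.
      (\<forall>i<k. laurent k (\<phi> i) \<and>
         (\<exists>g. laurent k g \<and> (\<forall>x\<in>torus k. leval k (\<phi> i) x * leval k g x = 1))) \<and>
      (\<forall>x. \<Phi> x = (\<lambda>i. if i < k then leval k (\<phi> i) x else 1)))"

definition zero_set :: "nat \<Rightarrow> ((nat \<Rightarrow> int) \<Rightarrow> 'a::field) set \<Rightarrow> (nat \<Rightarrow> 'a) set" where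
  "zero_set k F = {x\<in>torus k. \<forall>f\<in>F. leval k f x = 0}"

definition closed_subvariety :: "nat \<Rightarrow> ((nat \<Rightarrow> int) \<Rightarrow> 'a::field) set \<Rightarrow> bool" where
  "closed_subvariety k F \<longleftrightarrow> finite F \<and> (\<forall>f\<in>F. laurent k f)"

definition is_alg_closure_Fp :: "nat \<Rightarrow> 'k::alg_closed_field itself \<Rightarrow> bool" where
  "is_alg_closure_Fp p _ \<longleftrightarrow> CHAR('k) = p \<and>
     (\<forall>x::'k. \<exists>q::'k poly. q \<noteq> 0 \<and> (\<forall>i. coeff q i \<in> range of_nat) \<and> poly q x = 0)"

end

theory Submission
  imports Defs
begin

text \<open>
  Let t be the variable of K. A sequence of nonzero elements of K all of whose shifts lie, up to
  scalars, in one finite set is a coordinate of an orbit of a torus endomorphism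
  x_i \<mapsto> w_i x_(\<tau> i), so it suffices to write S as the common zero set of finitely many
  linear combinations of such sequences. These combinations form a ring containing all
  n \<mapsto> g^n and all eventually periodic sequences, which settles unions and progressions.

  Up to finite unions, periodic conditions and affine substitutions, a p-set is a set of sums
  \<Sum>j c_j q^(n_j) with positive integers c_j of sum C, where q is a power of p with 2 C < q. Let D be
  the set of all sums M of C powers of q. It is cut out by conditions on (t + x)^M for
  x in the field with q elements: this value must be a polynomial of degree C in x, which forces many
  binomial coefficients of M to vanish mod p. For M in D, say M = \<Sum>i q^(e_i), put
  r_i = t^(q^(e_i)). The remaining condition is that some assignment f satisfies
  t^M = \<Prod>j r_(f j)^(c_j). It becomes one equation after multiplying over all f, and the product
  is again a combination of sequences g^M because \<Prod>i (a(r_i) + z b(r_i)) can be interpolated in z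
  at the elements of the field with q elements, where it equals (a(t) + z b(t))^M.
\<close>

section \<open>Zero loci of linear combinations of sequences\<close>

definition orbit_closed :: "(nat \<Rightarrow> 'a::field) set \<Rightarrow> bool" where
  "orbit_closed Y \<longleftrightarrow> finite Y \<and>
     (\<forall>y\<in>Y. (\<forall>n. y n \<noteq> 0) \<and> (\<exists>w. \<exists>z\<in>Y. w \<noteq> 0 \<and> (\<forall>n. y (Suc n) = w * z n)))"

definition orbit_seqs :: "(nat \<Rightarrow> 'a::field) set" where
  "orbit_seqs = \<Union>{Y. orbit_closed Y}"

definition geom_seqs :: "(nat \<Rightarrow> 'a::field) set" where
  "geom_seqs = {\<lambda>n. g ^ n | g. g \<noteq> 0}"

text \<open>The set \<open>B\<close> is left open because two instances occur: geometric sequences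
  in M, which describe the power sums, and orbit sequences in n, into which they pass under M =
  floor((D n - b) / P).\<close>

inductive_set lincomb :: "(nat \<Rightarrow> 'a::field) set \<Rightarrow> (nat \<Rightarrow> 'a) set" for B where
  zero: "(\<lambda>_. 0) \<in> lincomb B"
| step: "y \<in> B \<Longrightarrow> f \<in> lincomb B \<Longrightarrow> (\<lambda>n. a * y n + f n) \<in> lincomb B"

definition zero_locus :: "(nat \<Rightarrow> 'a::field) set \<Rightarrow> nat set \<Rightarrow> bool" where
  "zero_locus B S \<longleftrightarrow> (\<exists>G. finite G \<and> G \<subseteq> lincomb B \<and> S = {n. \<forall>f\<in>G. f n = 0})"

lemma lincomb_base: "y \<in> B \<Longrightarrow> (\<lambda>n. a * y n) \<in> lincomb B"
  using lincomb.step[OF _ lincomb.zero, of y B a] by simp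

lemma lincomb_add:
  assumes "f \<in> lincomb B" "g \<in> lincomb B"
  shows "(\<lambda>n. f n + g n) \<in> lincomb B"
  using assms by (induction) (auto simp: add.assoc intro: lincomb.step)

lemma lincomb_sum:
  assumes "\<And>i. i \<in> I \<Longrightarrow> f i \<in> lincomb B"
  shows "(\<lambda>n. \<Sum>i\<in>I. f i n) \<in> lincomb B"
  using assms
  by (induction I rule: infinite_finite_induct) (auto intro: lincomb.zero lincomb_add)

lemma lincomb_scale_seq:
  assumes B: "\<And>y z. y \<in> B \<Longrightarrow> z \<in> B \<Longrightarrow> (\<lambda>n. y n * z n) \<in> B"
    and "y \<in> B" "f \<in> lincomb B"
  shows "(\<lambda>n. a * y n * f n) \<in> lincomb B"
  using assms(3)
proof induction
  case zero
  then show ?case by (simp add: lincomb.zero)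
next
  case (step z f b)
  have "(\<lambda>n. (a * b) * (y n * z n) + a * y n * f n) \<in> lincomb B"
    by (rule lincomb.step) (use B \<open>y \<in> B\<close> step in auto)
  moreover have "(\<lambda>n. (a * b) * (y n * z n) + a * y n * f n) = (\<lambda>n. a * y n * (b * z n + f n))"
    by (simp add: algebra_simps)
  ultimately show ?case by simp
qed

lemma lincomb_mult:
  assumes B: "\<And>y z. y \<in> B \<Longrightarrow> z \<in> B \<Longrightarrow> (\<lambda>n. y n * z n) \<in> B"
    and "f \<in> lincomb B" "g \<in> lincomb B"
  shows "(\<lambda>n. f n * g n) \<in> lincomb B"
  using assms(2)
proof induction
  case zero
  then show ?case by (simp add: lincomb.zero)
next
  case (step z f b)
  have "(\<lambda>n. b * z n * g n) \<in> lincomb B"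
    by (rule lincomb_scale_seq[OF B]) (use step assms in auto)
  from lincomb_add[OF this step(3)] show ?case by (simp add: distrib_right)
qed

lemma lincomb_reindex:
  assumes "\<And>y. y \<in> B \<Longrightarrow> (\<lambda>n. y (h n)) \<in> B'" "f \<in> lincomb B"
  shows "(\<lambda>n. f (h n)) \<in> lincomb B'"
  using assms(2) by induction (auto intro: lincomb.intros assms(1))

lemma lincomb_finite_sum:
  assumes "f \<in> lincomb B"
  shows "\<exists>Y a. finite Y \<and> Y \<subseteq> B \<and> f = (\<lambda>n. \<Sum>y\<in>Y. a y * y n)"
  using assms
proof induction
  case zero
  then show ?case by (intro exI[of _ "{}"]) auto
next
  case (step z f b)
  then obtain Y a where Y: "finite Y" "Y \<subseteq> B" "f = (\<lambda>n. \<Sum>y\<in>Y. a y * y n)" by auto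
  define a' where "a' y = (if y \<in> Y then a y else 0) + (if y = z then b else 0)" for y
  have "b * z n + f n = (\<Sum>y\<in>insert z Y. a' y * y n)" for n
  proof -
    have "(\<Sum>y\<in>insert z Y. a' y * y n) =
      (\<Sum>y\<in>insert z Y. (if y \<in> Y then a y * y n else 0)) + (\<Sum>y\<in>insert z Y. if y = z then b * z n else 0)"
      unfolding a'_def sum.distrib[symmetric] by (intro sum.cong) (auto simp: algebra_simps)
    also have "(\<Sum>y\<in>insert z Y. (if y \<in> Y then a y * y n else 0)) = (\<Sum>y\<in>Y. a y * y n)"
      using Y by (intro sum.mono_neutral_cong_right) auto
    finally show ?thesis using Y by (simp add: add.commute)
  qed
  then show ?case using Y step by (intro exI[of _ "insert z Y"] exI[of _ a']) auto
qed

lemma zero_locus_Int: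
  assumes "zero_locus B S" "zero_locus B T"
  shows "zero_locus B (S \<inter> T)"
proof -
  from assms obtain G H where "finite G" "G \<subseteq> lincomb B" "S = {n. \<forall>f\<in>G. f n = 0}"
    "finite H" "H \<subseteq> lincomb B" "T = {n. \<forall>f\<in>H. f n = 0}"
    unfolding zero_locus_def by blast
  then show ?thesis unfolding zero_locus_def by (intro exI[of _ "G \<union> H"]) auto
qed

lemma zero_locus_Inter:
  assumes "finite I" "\<And>i. i \<in> I \<Longrightarrow> zero_locus B (S i)"
  shows "zero_locus B {n. \<forall>i\<in>I. n \<in> S i}"
  using assms
proof (induction I)
  case empty
  then show ?case unfolding zero_locus_def by (intro exI[of _ "{}"]) auto
next
  case (insert i I)
  have "{n. \<forall>j\<in>insert i I. n \<in> S j} = S i \<inter> {n. \<forall>j\<in>I. n \<in> S j}" by auto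
  then show ?case using insert zero_locus_Int[of B "S i"] by simp
qed

lemma zero_locus_single: "f \<in> lincomb B \<Longrightarrow> zero_locus B {n. f n = 0}"
  unfolding zero_locus_def by (intro exI[of _ "{f}"]) auto

text \<open>The products f g, with f and g from the two defining families, all vanish at n exactly
  if one of the families vanishes there as a whole.\<close>

lemma zero_locus_Un:
  assumes B: "\<And>y z. y \<in> B \<Longrightarrow> z \<in> B \<Longrightarrow> (\<lambda>n. y n * z n) \<in> B"
    and "zero_locus B S" "zero_locus B T"
  shows "zero_locus B (S \<union> T)"
proof -
  from assms obtain G H where GH: "finite G" "G \<subseteq> lincomb B" "S = {n. \<forall>f\<in>G. f n = 0}"
    "finite H" "H \<subseteq> lincomb B" "T = {n. \<forall>f\<in>H. f n = 0}"
    unfolding zero_locus_def by blast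
  have "S \<union> T = {n. \<forall>f\<in>(\<lambda>(f, g) n. f n * g n) ` (G \<times> H). f n = 0}"
    unfolding GH(3,6) by auto
  moreover have "(\<lambda>(f, g) n. f n * g n) ` (G \<times> H) \<subseteq> lincomb B"
  proof (clarsimp simp: image_subset_iff)
    fix f g assume "f \<in> G" "g \<in> H"
    then show "(\<lambda>n. f n * g n) \<in> lincomb B"
      using GH(2,5) by (intro lincomb_mult[OF B]) auto
  qed
  ultimately show ?thesis
    unfolding zero_locus_def using GH(1,4)
    by (intro exI[of _ "(\<lambda>(f, g) n. f n * g n) ` (G \<times> H)"]) simp
qed

lemma zero_locus_empty:
  assumes "(\<lambda>_. 1) \<in> B"
  shows "zero_locus B {}"
  using zero_locus_single[OF lincomb_base[OF assms, of 1]] by simp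

lemma zero_locus_Union:
  assumes B: "\<And>y z. y \<in> B \<Longrightarrow> z \<in> B \<Longrightarrow> (\<lambda>n. y n * z n) \<in> B"
    and "(\<lambda>_. 1) \<in> B" "finite \<A>" "\<And>A. A \<in> \<A> \<Longrightarrow> zero_locus B A"
  shows "zero_locus B (\<Union>\<A>)"
  using assms(3,4)
proof (induction \<A>)
  case empty
  then show ?case using zero_locus_empty[OF assms(2)] by simp
next
  case (insert A \<A>)
  have "zero_locus B (A \<union> \<Union>\<A>)"
    by (rule zero_locus_Un[OF B]) (use insert in auto)
  then show ?case by simp
qed

lemma zero_locus_vimage:
  assumes "\<And>y. y \<in> B \<Longrightarrow> (\<lambda>n. y (h n)) \<in> B'" "zero_locus B S"
  shows "zero_locus B' (h -` S)"
proof -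
  from assms obtain G where G: "finite G" "G \<subseteq> lincomb B" "S = {n. \<forall>f\<in>G. f n = 0}"
    unfolding zero_locus_def by blast
  then show ?thesis
    unfolding zero_locus_def
    by (intro exI[of _ "(\<lambda>f n. f (h n)) ` G"]) (auto intro!: lincomb_reindex[OF assms(1)])
qed

section \<open>Products of orbit sequences and criteria for them\<close>

lemma orbit_seqs_mult:
  assumes "y \<in> orbit_seqs" "z \<in> orbit_seqs"
  shows "(\<lambda>n. y n * z n) \<in> orbit_seqs"
proof -
  from assms obtain Y Z where YZ: "orbit_closed Y" "y \<in> Y" "orbit_closed Z" "z \<in> Z"
    unfolding orbit_seqs_def by auto
  have "orbit_closed ((\<lambda>(y, z) n. y n * z n) ` (Y \<times> Z))"
    unfolding orbit_closed_def
  proof (intro conjI ballI)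
    show "finite ((\<lambda>(y, z) n. y n * z n) ` (Y \<times> Z))"
      using YZ unfolding orbit_closed_def by auto
    fix x assume "x \<in> (\<lambda>(y, z) n. y n * z n) ` (Y \<times> Z)"
    then obtain a b where ab: "a \<in> Y" "b \<in> Z" "x = (\<lambda>n. a n * b n)" by auto
    obtain w a' where a': "w \<noteq> 0" "a' \<in> Y" "\<And>n. a (Suc n) = w * a' n"
      using YZ ab unfolding orbit_closed_def by metis
    obtain v b' where b': "v \<noteq> 0" "b' \<in> Z" "\<And>n. b (Suc n) = v * b' n"
      using YZ ab unfolding orbit_closed_def by metis
    show "\<forall>n. x n \<noteq> 0" using YZ ab unfolding orbit_closed_def by auto
    show "\<exists>w. \<exists>z\<in>(\<lambda>(y, z) n. y n * z n) ` (Y \<times> Z). w \<noteq> 0 \<and> (\<forall>n. x (Suc n) = w * z n)"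
      using a' b' ab by (intro exI[of _ "w * v"] bexI[of _ "\<lambda>n. a' n * b' n"]) (auto simp: algebra_simps)
  qed
  then show ?thesis unfolding orbit_seqs_def using YZ by (auto intro!: exI[of _ "(\<lambda>(y, z) n. y n * z n) ` (Y \<times> Z)"])
qed

text \<open>The shifts of \<open>y\<close> by less than N + b form a finite closed family: the next
  one, by N + b, is g times the shift by N.\<close>

lemma orbit_seqsI:
  assumes nz: "\<And>n. y n \<noteq> 0" and "g \<noteq> 0" "b > 0" and rec: "\<And>n. n \<ge> N \<Longrightarrow> y (n + b) = g * y n"
  shows "y \<in> orbit_seqs"
proof -
  define Y where "Y = (\<lambda>k n. y (n + k)) ` {..<N + b}"
  have "orbit_closed Y"
    unfolding orbit_closed_def
  proof (intro conjI ballI)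
    show "finite Y" by (simp add: Y_def)
    fix x assume "x \<in> Y"
    then obtain k where k: "k < N + b" "x = (\<lambda>n. y (n + k))" by (auto simp: Y_def)
    show "\<forall>n. x n \<noteq> 0" using nz k by auto
    show "\<exists>w. \<exists>z\<in>Y. w \<noteq> 0 \<and> (\<forall>n. x (Suc n) = w * z n)"
    proof (cases "Suc k < N + b")
      case True
      then have "(\<lambda>n. y (n + Suc k)) \<in> Y" unfolding Y_def by (intro image_eqI[of _ _ "Suc k"]) auto
      then show ?thesis using k by (intro exI[of _ 1] bexI[of _ "\<lambda>n. y (n + Suc k)"]) auto
    next
      case False
      then have "Suc k = N + b" using k by simp
      then have "x (Suc n) = y ((n + N) + b)" for n
        using k(2) by (metis add.assoc add_Suc_shift)
      then show ?thesis using assms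
        by (intro exI[of _ g] bexI[of _ "\<lambda>n. y (n + N)"]) (auto simp: Y_def)
    qed
  qed
  moreover have "y \<in> Y" unfolding Y_def using \<open>b > 0\<close> by (auto intro!: image_eqI[of _ _ 0])
  ultimately show ?thesis unfolding orbit_seqs_def by auto
qed

lemma const_in_orbit_seqs: "a \<noteq> 0 \<Longrightarrow> (\<lambda>_. a) \<in> orbit_seqs"
  by (rule orbit_seqsI[of _ 1 1 0]) auto

lemma geom_seqs_mult: "y \<in> geom_seqs \<Longrightarrow> z \<in> geom_seqs \<Longrightarrow> (\<lambda>n. y n * z n) \<in> geom_seqs"
  unfolding geom_seqs_def by (force simp: power_mult_distrib[symmetric])

lemma power_in_geom_seqs: "g \<noteq> 0 \<Longrightarrow> (\<lambda>n. g ^ n) \<in> geom_seqs"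
  unfolding geom_seqs_def by auto

lemma zero_locus_eventually_periodic:
  assumes "b > 0" and per: "\<And>n. n \<ge> N \<Longrightarrow> n + b \<in> E \<longleftrightarrow> n \<in> E"
    and "(x::'a::field) \<noteq> 0" "x \<noteq> 1"
  shows "zero_locus (orbit_seqs :: (nat \<Rightarrow> 'a) set) E"
proof -
  define y where "y n = (if n \<in> E then 1 else x)" for n
  have "y \<in> orbit_seqs"
    by (rule orbit_seqsI[of _ 1 b N]) (use assms in \<open>auto simp: y_def\<close>)
  then have "(\<lambda>n. 1 * y n + (-1) * 1) \<in> lincomb orbit_seqs"
    by (intro lincomb.step lincomb_base const_in_orbit_seqs) auto
  from zero_locus_single[OF this] have "zero_locus (orbit_seqs :: (nat \<Rightarrow> 'a) set) {n. y n = 1}" by simp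
  also have "{n. y n = 1} = E" using assms by (auto simp: y_def)
  finally show ?thesis .
qed

section \<open>Realization on a torus\<close>

definition unit_exp :: "nat \<Rightarrow> int \<Rightarrow> nat \<Rightarrow> int" where
  "unit_exp i d = (\<lambda>l. if l = i then d else 0)"

lemma prod_powi_unit_exp:
  fixes x :: "nat \<Rightarrow> 'a::field"
  shows "i < k \<Longrightarrow> (\<Prod>l<k. x l powi unit_exp i d l) = x i powi d"
  by (simp add: unit_exp_def if_distrib[of "\<lambda>e. _ powi e"] prod.delta cong: if_cong)

lemma unit_exp_inject: "unit_exp i 1 = unit_exp j 1 \<longleftrightarrow> i = j"
  unfolding unit_exp_def fun_eq_iff by (metis zero_neq_one)

definition mono_coeff :: "nat \<Rightarrow> int \<Rightarrow> 'a::field \<Rightarrow> (nat \<Rightarrow> int) \<Rightarrow> 'a" where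
  "mono_coeff i d a = (\<lambda>e. if e = unit_exp i d then a else 0)"

lemma laurent_mono_coeff: "i < k \<Longrightarrow> laurent k (mono_coeff i d a)"
  unfolding laurent_def mono_coeff_def by (auto simp: unit_exp_def)

lemma leval_mono_coeff:
  assumes "i < k"
  shows "leval k (mono_coeff i d a) x = a * x i powi d"
proof -
  have "leval k (mono_coeff i d a) x = (\<Sum>e\<in>{unit_exp i d}. mono_coeff i d a e * (\<Prod>l<k. x l powi e l))"
    unfolding leval_def by (rule sum.mono_neutral_left) (auto simp: mono_coeff_def)
  then show ?thesis using assms by (simp add: mono_coeff_def prod_powi_unit_exp)
qed

definition linear_coeff :: "nat \<Rightarrow> (nat \<Rightarrow> 'a::field) \<Rightarrow> (nat \<Rightarrow> int) \<Rightarrow> 'a" where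
  "linear_coeff k a = (\<lambda>e. \<Sum>i<k. if e = unit_exp i 1 then a i else 0)"

lemma linear_coeff_support: "{e. linear_coeff k a e \<noteq> 0} \<subseteq> (\<lambda>i. unit_exp i 1) ` {..<k}"
proof
  fix e assume "e \<in> {e. linear_coeff k a e \<noteq> 0}"
  then have "(\<Sum>i<k. if e = unit_exp i 1 then a i else 0) \<noteq> 0" by (simp add: linear_coeff_def)
  then show "e \<in> (\<lambda>i. unit_exp i 1) ` {..<k}"
    by (rule contrapos_np) (auto intro!: sum.neutral)
qed

lemma laurent_linear_coeff: "laurent k (linear_coeff k a)"
proof -
  have "finite {e. linear_coeff k a e \<noteq> 0}"
    by (rule finite_subset[OF linear_coeff_support]) auto
  moreover have "e i = 0" if "linear_coeff k a e \<noteq> 0" "i \<ge> k" for e i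
    using linear_coeff_support[of k a] that by (auto simp: unit_exp_def)
  ultimately show ?thesis unfolding laurent_def by auto
qed

lemma leval_linear_coeff: "leval k (linear_coeff k a) x = (\<Sum>i<k. a i * x i)"
proof -
  have "leval k (linear_coeff k a) x =
      (\<Sum>e\<in>(\<lambda>i. unit_exp i 1) ` {..<k}. linear_coeff k a e * (\<Prod>l<k. x l powi e l))"
    unfolding leval_def
    by (rule sum.mono_neutral_left) (use linear_coeff_support in auto)
  also have "\<dots> = (\<Sum>i<k. linear_coeff k a (unit_exp i 1) * (\<Prod>l<k. x l powi unit_exp i 1 l))"
    by (rule sum.reindex_cong[of "\<lambda>i. unit_exp i 1"]) (auto simp: inj_on_def unit_exp_inject)
  also have "\<dots> = (\<Sum>i<k. a i * x i)"
    by (intro sum.cong refl) (simp add: prod_powi_unit_exp linear_coeff_def unit_exp_inject)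
  finally show ?thesis .
qed

lemma orbit_closed_Un:
  assumes "finite I" "\<And>i. i \<in> I \<Longrightarrow> orbit_closed (Y i)"
  shows "orbit_closed (\<Union>i\<in>I. Y i)"
  unfolding orbit_closed_def
proof (intro conjI ballI)
  show "finite (\<Union>i\<in>I. Y i)" using assms by (auto simp: orbit_closed_def)
  fix y assume "y \<in> (\<Union>i\<in>I. Y i)"
  then obtain i where i: "i \<in> I" "y \<in> Y i" by auto
  then have Y: "(\<forall>n. y n \<noteq> 0) \<and> (\<exists>w. \<exists>z\<in>Y i. w \<noteq> 0 \<and> (\<forall>n. y (Suc n) = w * z n))"
    using assms(2)[of i] unfolding orbit_closed_def by blast
  then show "\<forall>n. y n \<noteq> 0" by blast
  from Y show "\<exists>w. \<exists>z\<in>(\<Union>i\<in>I. Y i). w \<noteq> 0 \<and> (\<forall>n. y (Suc n) = w * z n)" using i(1) by blast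
qed

text \<open>The closed families containing the finitely many sequences that occur are united into
  one. Adjoining the constant sequence 1 makes it nonempty, so that the torus gets positive
  dimension.\<close>

lemma lincomb_orbit_seqs_expand:
  assumes "finite G" "G \<subseteq> lincomb orbit_seqs"
  shows "\<exists>Y A. orbit_closed Y \<and> Y \<noteq> {} \<and> (\<forall>f\<in>G. \<forall>n. f n = (\<Sum>y\<in>Y. A f y * y n))"
proof -
  have ex: "\<exists>Y a. finite Y \<and> Y \<subseteq> orbit_seqs \<and> (\<forall>n. f n = (\<Sum>y\<in>Y. a y * y n))" if "f \<in> G" for f
  proof -
    have "f \<in> lincomb orbit_seqs" using assms(2) that by blast
    from lincomb_finite_sum[OF this] obtain Y a where
      "finite Y" "Y \<subseteq> orbit_seqs" and f: "f = (\<lambda>n. \<Sum>y\<in>Y. a y * y n)" by blast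
    moreover have "f n = (\<Sum>y\<in>Y. a y * y n)" for n by (rule fun_cong[OF f])
    ultimately show ?thesis by blast
  qed
  then have "\<exists>Y. \<forall>f\<in>G. \<exists>a. finite (Y f) \<and> Y f \<subseteq> orbit_seqs \<and> (\<forall>n. f n = (\<Sum>y\<in>Y f. a y * y n))"
    by (intro bchoice ballI)
  then obtain Y where Y0: "\<forall>f\<in>G. \<exists>a. finite (Y f) \<and> Y f \<subseteq> orbit_seqs \<and> (\<forall>n. f n = (\<Sum>y\<in>Y f. a y * y n))"
    by (elim exE)
  from bchoice[OF this] obtain a where
    Y': "\<forall>f\<in>G. finite (Y f) \<and> Y f \<subseteq> orbit_seqs \<and> (\<forall>n. f n = (\<Sum>y\<in>Y f. a f y * y n))"
    by (elim exE)
  then have Y: "\<And>f. f \<in> G \<Longrightarrow> finite (Y f)" "\<And>f. f \<in> G \<Longrightarrow> Y f \<subseteq> orbit_seqs"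
    "\<And>f n. f \<in> G \<Longrightarrow> f n = (\<Sum>y\<in>Y f. a f y * y n)" by blast+
  define Y0 where "Y0 = insert (\<lambda>_. 1) (\<Union>f\<in>G. Y f)"
  have Y0: "finite Y0" "Y0 \<subseteq> orbit_seqs"
    using Y assms const_in_orbit_seqs[of 1] unfolding Y0_def by auto
  have "\<forall>y\<in>Y0. \<exists>Z. orbit_closed Z \<and> y \<in> Z" using Y0 unfolding orbit_seqs_def by auto
  then obtain Z where Z: "\<And>y. y \<in> Y0 \<Longrightarrow> orbit_closed (Z y)" "\<And>y. y \<in> Y0 \<Longrightarrow> y \<in> Z y" by metis
  define W where "W = (\<Union>y\<in>Y0. Z y)"
  have W: "orbit_closed W" unfolding W_def by (rule orbit_closed_Un) (use Y0 Z in auto)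
  have YW: "Y f \<subseteq> W" if "f \<in> G" for f using that Z unfolding W_def Y0_def by auto
  have "f n = (\<Sum>y\<in>W. (if y \<in> Y f then a f y else 0) * y n)" if f: "f \<in> G" for f n
  proof -
    have "(\<Sum>y\<in>W. (if y \<in> Y f then a f y else 0) * y n) = (\<Sum>y\<in>Y f. a f y * y n)"
      using YW[OF f] W unfolding orbit_closed_def by (intro sum.mono_neutral_cong_right) auto
    then show "f n = (\<Sum>y\<in>W. (if y \<in> Y f then a f y else 0) * y n)"
      using Y(3)[OF f, of n] by simp
  qed
  moreover have "W \<noteq> {}" using Z(2)[of "\<lambda>_. 1"] unfolding W_def Y0_def by blast
  ultimately show ?thesis
    using W by (intro exI[of _ W] exI[of _ "\<lambda>f y. if y \<in> Y f then a f y else 0"]) auto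
qed

text \<open>The members of one closed family serve as coordinates: the shift becomes x_i -> w_i
  x_(tau i), and each defining sequence becomes a linear form on the torus.\<close>

lemma torus_realization:
  fixes S :: "nat set"
  assumes "zero_locus (orbit_seqs :: (nat \<Rightarrow> 'a::field) set) S"
  shows "\<exists>(k::nat) (\<Phi> :: (nat \<Rightarrow> 'a) \<Rightarrow> (nat \<Rightarrow> 'a)) \<alpha> F.
           k \<ge> 1 \<and> torus_endo k \<Phi> \<and> \<alpha> \<in> torus k \<and> closed_subvariety k F \<and>
           {n. (\<Phi> ^^ n) \<alpha> \<in> zero_set k F} = S"
proof -
  from assms obtain G :: "(nat \<Rightarrow> 'a) set" where
    G: "finite G" "G \<subseteq> lincomb orbit_seqs" "S = {n. \<forall>f\<in>G. f n = 0}"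
    unfolding zero_locus_def by blast
  from lincomb_orbit_seqs_expand[OF G(1,2)] obtain Y A where
    Y: "orbit_closed Y" "Y \<noteq> {}" and A: "\<And>f n. f \<in> G \<Longrightarrow> f n = (\<Sum>y\<in>Y. A f y * y n)" by blast
  have finY: "finite Y" using Y by (simp add: orbit_closed_def)
  define k where "k = card Y"
  obtain s where s: "bij_betw s {..<k} Y"
    using ex_bij_betw_nat_finite[OF finY] unfolding k_def by (auto simp: atLeast0LessThan)
  have sY: "s i \<in> Y" if "i < k" for i using s that by (auto simp: bij_betw_def)
  have "\<exists>w j. w \<noteq> 0 \<and> j < k \<and> (\<forall>n. s i (Suc n) = w * s j n)" if i: "i < k" for i
  proof -
    obtain w z where wz: "w \<noteq> 0" "z \<in> Y" "\<forall>n. s i (Suc n) = w * z n"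
      using Y sY[OF i] unfolding orbit_closed_def by metis
    then obtain j where "j < k" "z = s j" using s by (auto simp: bij_betw_def)
    then show ?thesis using wz by blast
  qed
  then obtain w \<tau> where w: "\<And>i. i < k \<Longrightarrow> w i \<noteq> 0" and \<tau>: "\<And>i. i < k \<Longrightarrow> \<tau> i < k"
    and rec: "\<And>i n. i < k \<Longrightarrow> s i (Suc n) = w i * s (\<tau> i) n" by metis
  define \<phi> where "\<phi> i = mono_coeff (\<tau> i) 1 (w i)" for i
  define \<Phi> where "\<Phi> = (\<lambda>x i. if i < k then leval k (\<phi> i) x else 1)"
  define P where "P = (\<lambda>n i. if i < k then s i n else 1)"
  define F where "F = (\<lambda>f. linear_coeff k (\<lambda>i. A f (s i))) ` G"
  have "torus_endo k \<Phi>"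
    unfolding torus_endo_def
  proof (intro exI[of _ \<phi>] conjI allI impI)
    fix i assume i: "i < k"
    show "laurent k (\<phi> i)" unfolding \<phi>_def using \<tau>[OF i] by (rule laurent_mono_coeff)
    \<comment> \<open>The inverse monomial shows that the component is a unit of the coordinate
      ring.\<close>
    show "\<exists>g. laurent k g \<and> (\<forall>x\<in>torus k. leval k (\<phi> i) x * leval k g x = 1)"
    proof (intro exI[of _ "mono_coeff (\<tau> i) (-1) (inverse (w i))"] conjI ballI)
      show "laurent k (mono_coeff (\<tau> i) (-1) (inverse (w i)))"
        using \<tau>[OF i] by (rule laurent_mono_coeff)
      fix x :: "nat \<Rightarrow> 'a" assume "x \<in> torus k"
      then have "x (\<tau> i) \<noteq> 0" using \<tau>[OF i] by (auto simp: torus_def)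
      then show "leval k (\<phi> i) x * leval k (mono_coeff (\<tau> i) (-1) (inverse (w i))) x = 1"
        unfolding \<phi>_def using w[OF i] by (simp add: leval_mono_coeff \<tau>[OF i] power_int_minus field_simps)
    qed
  qed (simp add: \<Phi>_def)
  moreover have P_torus: "P n \<in> torus k" for n
    using Y sY unfolding orbit_closed_def torus_def P_def by auto
  moreover have "closed_subvariety k F"
    unfolding closed_subvariety_def F_def using G(1) by (auto intro: laurent_linear_coeff)
  moreover have "k \<ge> 1" using finY Y(2) unfolding k_def by (simp add: Suc_le_eq card_gt_0_iff)
  moreover have "{n. (\<Phi> ^^ n) (P 0) \<in> zero_set k F} = S"
  proof -
    have "\<Phi> (P n) = P (Suc n)" for n
      unfolding \<Phi>_def P_def \<phi>_def by (auto simp: leval_mono_coeff \<tau> rec fun_eq_iff)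
    then have orb: "(\<Phi> ^^ n) (P 0) = P n" for n by (induction n) auto
    have ev: "leval k (linear_coeff k (\<lambda>i. A f (s i))) (P n) = f n" if "f \<in> G" for f n
    proof -
      have "leval k (linear_coeff k (\<lambda>i. A f (s i))) (P n) = (\<Sum>i<k. A f (s i) * s i n)"
        by (simp add: leval_linear_coeff P_def)
      also have "\<dots> = (\<Sum>y\<in>Y. A f y * y n)" by (rule sum.reindex_bij_betw[OF s])
      also have "\<dots> = f n" using A[OF that, of n] by simp
      finally show ?thesis .
    qed
    show ?thesis unfolding orb zero_set_def G(3) F_def using P_torus ev by auto
  qed
  ultimately show ?thesis by (intro exI[of _ k] exI[of _ \<Phi>] exI[of _ "P 0"] exI[of _ F]) auto
qed

section \<open>Sums of a fixed number of powers of q\<close>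

text \<open>Compare the coefficients of X^(p^f) in (1 + X)^(p^f m) = (1 + X^(p^f))^m.\<close>

lemma of_nat_choose_char_power:
  assumes "prime p" "CHAR('a::field) = p"
  shows "of_nat (p ^ f * m choose p ^ f) = (of_nat m :: 'a)"
proof (cases "m = 0")
  case True
  moreover have "p ^ f > 0" using assms by (simp add: prime_gt_0_nat)
  ultimately show ?thesis by (simp add: binomial_eq_0)
next
  case False
  define P where "P = p ^ f"
  have P: "P > 0" using assms by (simp add: P_def prime_gt_0_nat)
  have "(monom 1 1 + 1 :: 'a poly) ^ P = monom 1 1 ^ P + 1 ^ P"
    by (rule freshmans_dream'[of _ f]) (use assms in \<open>auto simp: P_def\<close>)
  moreover have "monom 1 1 + 1 = [:1, 1 :: 'a:]"
    by (simp add: monom_Suc one_pCons)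
  ultimately have fd: "[:1, 1 :: 'a:] ^ P = monom 1 P + 1"
    by (simp add: monom_power)
  have "of_nat (P * m choose P) = coeff ([:1, 1 :: 'a:] ^ (P * m)) P"
    using False by (subst coeff_linear_poly_power) auto
  also have "[:1, 1 :: 'a:] ^ (P * m) = (\<Sum>l\<le>m. of_nat (m choose l) * monom 1 P ^ l)"
    unfolding power_mult fd by (subst binomial_ring) simp
  also have "coeff \<dots> P = (\<Sum>l\<le>m. if l = 1 then of_nat m else 0)"
    unfolding coeff_sum
    by (intro sum.cong refl) (use P in \<open>auto simp: monom_power of_nat_poly\<close>)
  also have "\<dots> = of_nat m" using False by simp
  finally show ?thesis by (simp add: P_def)
qed

text \<open>This rests on (M choose b) (b choose a) = (M choose a) (M - a choose b - a).\<close>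

lemma not_dvd_choose_trans:
  fixes p :: nat
  assumes "prime p" "a \<le> b" "b \<le> M" "\<not> p dvd (M choose b)" "\<not> p dvd (b choose a)"
  shows "\<not> p dvd (M choose a)"
proof
  assume "p dvd (M choose a)"
  then have "p dvd (M choose b) * (b choose a)"
    using choose_mult[OF assms(2,3)] by simp
  then show False using assms by (simp add: prime_dvd_mult_iff)
qed

definition power_sums :: "nat \<Rightarrow> nat \<Rightarrow> nat set" where
  "power_sums q C = {\<Sum>i<C. q ^ e i | e. True}"

lemma power_sums_add:
  assumes "a \<in> power_sums q v" "b \<in> power_sums q w"
  shows "a + b \<in> power_sums q (v + w)"
proof -
  from assms obtain e g where e: "a = (\<Sum>i<v. q ^ e i)" "b = (\<Sum>i<w. q ^ g i)"
    unfolding power_sums_def by auto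
  define h where "h i = (if i < v then e i else g (i - v))" for i
  have "(\<Sum>i<v + w. q ^ h i) = (\<Sum>i<v. q ^ h i) + (\<Sum>i<w. q ^ h (v + i))"
    by (induction w) auto
  then have "a + b = (\<Sum>i<v + w. q ^ h i)" by (simp add: e h_def)
  then show ?thesis unfolding power_sums_def by auto
qed

text \<open>Each power of q is congruent to 1 modulo q - 1.\<close>

lemma power_sums_mod:
  assumes "a \<in> power_sums q C" "q > 0"
  shows "a mod (q - 1) = C mod (q - 1)"
proof -
  obtain e where a: "a = (\<Sum>i<C. q ^ e i)" using assms unfolding power_sums_def by auto
  have "q mod (q - 1) = 1 mod (q - 1)" using mod_add_self2[of 1 "q - 1"] assms(2) by simp
  then have "q ^ e i mod (q - 1) = 1 mod (q - 1)" for i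
    by (metis power_mod power_one)
  then have "(\<Sum>i<C. q ^ e i mod (q - 1)) mod (q - 1) = (\<Sum>i<C. 1 mod (q - 1)) mod (q - 1)" by simp
  then have "(\<Sum>i<C. q ^ e i) mod (q - 1) = (\<Sum>i<C. 1) mod (q - 1)" by (simp only: mod_sum_eq)
  then show ?thesis by (simp add: a)
qed

text \<open>Take p^(f mod k) copies of the single power (p^k)^(f div k).\<close>

lemma prime_power_in_power_sums: "(p::nat) ^ f \<in> power_sums (p ^ k) (p ^ (f mod k))"
proof -
  have "p ^ f = p ^ (f mod k) * (p ^ k) ^ (f div k)"
    unfolding power_mult[symmetric] power_add[symmetric] by simp
  then show ?thesis unfolding power_sums_def by (auto intro!: exI[of _ "\<lambda>_. f div k"])
qed

text \<open>
  Removing the largest power of p dividing b from b keeps the binomial coefficient nonzero mod p.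
  Each removed power is a sum of at most C powers of q, and since 2 C < q the residue of b mod
  q - 1 then pins down the number of powers of q in b.
\<close>
lemma in_power_sums_if_binomials_vanish:
  fixes p k C M :: nat
  assumes p: "prime p" "CHAR('a::field) = p" and k: "k > 0" and q: "q = p ^ k" "q \<ge> 3" "2 * C < q"
    and van: "\<And>b. 0 < b \<Longrightarrow> b \<le> M \<Longrightarrow> \<not> p dvd (M choose b) \<Longrightarrow> b mod (q - 1) \<in> {1..C}"
    and M: "M mod (q - 1) = C mod (q - 1)"
  shows "M \<in> power_sums q C"
proof -
  have sub: "b \<le> M \<Longrightarrow> b = 0 \<or> \<not> p dvd (M choose b) \<Longrightarrow> \<exists>w\<le>C. b \<in> power_sums q w" for b
  proof (induction b rule: less_induct)
    case (less b)
    show ?case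
    proof (cases "b = 0")
      case True
      then show ?thesis by (auto intro!: exI[of _ 0] simp: power_sums_def)
    next
      case False
      define f where "f = multiplicity p b"
      obtain m where m: "b = p ^ f * m" "\<not> p dvd m"
        using multiplicity_decompose'[of b p] False p unfolding f_def
        by (metis not_prime_unit)
      define P where "P = p ^ f"
      have P: "0 < P" "P \<le> b" using m False p by (auto simp: P_def prime_gt_0_nat)
      \<comment> \<open>As b / P is prime to p, (b choose P) is nonzero mod p. Hence both P and b -
        P inherit from b that the binomial coefficient of M is nonzero.\<close>
      have nb: "\<not> p dvd (b choose P)"
        using of_nat_choose_char_power[OF p, of f m] m(2) of_nat_eq_0_iff_char_dvd[where 'a = 'a] p
        unfolding P_def m(1) by metis
      have Mb: "\<not> p dvd (M choose b)" using less.prems False by simp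
      have MP: "\<not> p dvd (M choose P)" by (rule not_dvd_choose_trans[OF p(1) P(2) less.prems(1) Mb nb])
      have nb': "\<not> p dvd (b choose (b - P))" using nb binomial_symmetric[OF P(2)] by simp
      have "\<not> p dvd (M choose (b - P))"
        by (rule not_dvd_choose_trans[OF p(1) _ less.prems(1) Mb nb']) simp
      then obtain w where w: "w \<le> C" "b - P \<in> power_sums q w"
        using less.IH[of "b - P"] P less.prems by fastforce
      define v where "v = p ^ (f mod k)"
      have Pv: "P \<in> power_sums q v" unfolding P_def q v_def by (rule prime_power_in_power_sums)
      \<comment> \<open>The number v of summands is at most p^(k - 1), hence at most q / 2. Since q
        >= 3 it is below q - 1 and equals the residue of P, which \<open>van\<close> bounds by
        C.\<close>
      have "f mod k \<le> k - 1" using k by (metis Suc_pred' less_Suc_eq_le mod_less_divisor)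
      then have "v \<le> p ^ (k - 1)" unfolding v_def using p prime_ge_1_nat by (intro power_increasing) auto
      moreover have "q = p * p ^ (k - 1)" using k q by (metis power_eq_if not_gr_zero)
      ultimately have "2 * v \<le> q" using prime_ge_2_nat[OF p(1)] by (simp add: mult_le_mono)
      then have "v < q - 1" using q by linarith
      moreover have "P mod (q - 1) = v mod (q - 1)" by (rule power_sums_mod[OF Pv]) (use q(2) in linarith)
      moreover have "P mod (q - 1) \<in> {1..C}" using van[OF P(1)] MP P(2) less.prems by auto
      ultimately have v: "v \<le> C" "1 \<le> v" by auto
      have "(b - P) + P \<in> power_sums q (w + v)" by (rule power_sums_add[OF w(2) Pv])
      then have b: "b \<in> power_sums q (w + v)" using P by simp
      then have "b mod (q - 1) = (w + v) mod (q - 1)" by (rule power_sums_mod) (use q(2) in linarith)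
      moreover have "b mod (q - 1) \<in> {1..C}" using van[of b] False less.prems by auto
      ultimately have r: "(w + v) mod (q - 1) \<in> {1..C}" by simp
      \<comment> \<open>Here w + v <= 2 C < q. The value q - 1 has the excluded residue 0, so w + v
        is its own residue and at most C.\<close>
      have "w + v \<noteq> q - 1" using r by auto
      then have "w + v < q - 1" using w v q by linarith
      then have "w + v \<le> C" using r by auto
      then show ?thesis using b by blast
    qed
  qed
  obtain w where w: "w \<le> C" "M \<in> power_sums q w" using sub[of M] prime_gt_1_nat[OF p(1)] by auto
  \<comment> \<open>Both w and C are below q - 1, so their congruence is an equality.\<close>
  have "w mod (q - 1) = C mod (q - 1)" using power_sums_mod[OF w(2)] M q(2) by fastforce
  then have "w = C" using w q by auto
  then show ?thesis using w by simp
qed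

section \<open>The field with q elements and its power sums\<close>

lemma card_frobenius_fixed:
  assumes "prime p" "CHAR('a::alg_closed_field) = p" "k > 0"
  shows "card {x::'a. x ^ (p ^ k) = x} = p ^ k"
proof -
  define q where "q = p ^ k"
  have q: "q > 1" using assms prime_gt_1_nat[of p] unfolding q_def by (intro one_less_power) auto
  define P where "P = (monom 1 q + monom (-1) 1 :: 'a poly)"
  have ev: "poly P x = x ^ q - x" for x by (simp add: P_def poly_monom)
  have "degree P = q"
    unfolding P_def using q by (subst degree_add_eq_left) (auto simp: degree_monom_eq)
  have P0: "P \<noteq> 0" using \<open>degree P = q\<close> q by auto
  have "of_nat q = (0 :: 'a)"
    using assms by (simp add: of_nat_eq_0_iff_char_dvd q_def)
  \<comment> \<open>The derivative of X^q - X is -1, so all roots are simple. As the polynomial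
    splits over an algebraically closed field, it has q distinct roots.\<close>
  then have pd: "poly (pderiv P) x = -1" for x
    by (simp add: P_def pderiv_add pderiv_monom poly_monom)
  have ord: "order x P = 1" if x: "poly P x = 0" for x
  proof -
    obtain R where R: "P = [:-x, 1:] * R" using x unfolding poly_eq_0_iff_dvd dvd_def by blast
    then have "poly R x = -1" using pd[of x] unfolding R pderiv_mult by (simp add: pderiv_pCons)
    then have "order x R = 0" by (intro order_0I) auto
    moreover have "order x [:-x, 1:] = 1" using order_power_n_n[of x 1] by simp
    ultimately show ?thesis using order_mult[of "[:-x, 1:]" R x] P0 R by simp
  qed
  obtain A where A: "size A = degree P" "P = smult (lead_coeff P) (\<Prod>x\<in>#A. [:-x, 1:])"
    using alg_closed_imp_factorization[OF P0] by blast
  have "proots P = A"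
  proof -
    have "proots P = proots (\<Prod>x\<in>#A. [:-x, 1:])"
      using A(2) P0 by (metis leading_coeff_0_iff proots_smult)
    also have "\<dots> = A"
    proof (induction A)
      case (add x A)
      have "(\<Prod>x\<in>#A. [:-x, 1:]) \<noteq> 0" by (auto simp: prod_mset_zero_iff)
      then have "proots ([:-x, 1:] * (\<Prod>x\<in>#A. [:-x, 1:])) = add_mset x A"
        using add by (subst proots_mult) auto
      then show ?case by (simp only: image_mset_add_mset prod_mset.add_mset)
    qed simp
    finally show ?thesis .
  qed
  then have "q = size (proots P)" using A \<open>degree P = q\<close> by simp
  also have "\<dots> = (\<Sum>x\<in>{x. poly P x = 0}. 1)"
    unfolding size_multiset_overloaded_eq using P0 by (simp add: ord)
  also have "\<dots> = card {x::'a. x ^ q = x}" by (simp add: ev)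
  finally show ?thesis by (simp add: q_def)
qed

text \<open>Multiplication by a nonzero z in F permutes F, so the sum equals z^e times itself. For e
  > 0 some z has z^e different from 1, because X^e - 1 has at most e < q - 1 roots; for e = 0 the
  sum is q = 0.\<close>

lemma sum_power_frobenius_fixed_0:
  fixes F :: "'a::field set"
  assumes F: "F = {x. x ^ q = x}" "card F = q" "of_nat q = (0::'a)" and e: "e < q - 1"
  shows "(\<Sum>x\<in>F. x ^ e) = 0"
proof (cases "e = 0")
  case True
  then show ?thesis using F by simp
next
  case False
  have fin: "finite F" using F(2) e by (intro card_ge_0_finite) simp
  have "\<exists>z\<in>F - {0}. z ^ e \<noteq> 1"
  proof (rule ccontr)
    assume "\<not> ?thesis"
    then have sub: "F - {0} \<subseteq> {x. poly (monom 1 e + [:-1:]) x = 0}" by (auto simp: poly_monom)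
    have d: "degree (monom (1::'a) e + [:-1:]) = e"
      using False by (subst degree_add_eq_left) (auto simp: degree_monom_eq)
    then have nz: "monom (1::'a) e + [:-1:] \<noteq> 0" using False by force
    have "card (F - {0}) \<le> card {x. poly (monom 1 e + [:-1:]) x = (0::'a)}"
      by (rule card_mono[OF poly_roots_finite[OF nz] sub])
    also have "\<dots> \<le> e" using card_poly_roots_bound[OF nz] d by simp
    finally have "card (F - {0}) \<le> e" .
    moreover have "card (F - {0}) \<ge> q - 1" using F(2) fin by (simp add: card_Diff_singleton_if)
    ultimately show False using e by simp
  qed
  then obtain z where z: "z \<in> F" "z \<noteq> 0" "z ^ e \<noteq> 1" by auto
  have "(*) z ` F \<subseteq> F" using z unfolding F(1) by (auto simp: power_mult_distrib)
  moreover have inj: "inj_on ((*) z) F" using z by (auto simp: inj_on_def)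
  ultimately have "(*) z ` F = F" using fin by (simp add: endo_inj_surj)
  then have "(\<Sum>x\<in>F. x ^ e) = (\<Sum>x\<in>F. (z * x) ^ e)"
    using sum.reindex[OF inj, of "\<lambda>x. x ^ e"] by simp
  also have "\<dots> = z ^ e * (\<Sum>x\<in>F. x ^ e)" by (simp add: power_mult_distrib sum_distrib_left)
  finally have "(1 - z ^ e) * (\<Sum>x\<in>F. x ^ e) = 0" by (simp add: algebra_simps)
  then show ?thesis using z by simp
qed

text \<open>Every nonzero x contributes 1 and 0 contributes 0, which gives q - 1 = -1.\<close>

lemma sum_power_frobenius_fixed_dvd:
  fixes F :: "'a::field set"
  assumes F: "F = {x. x ^ q = x}" "card F = q" "of_nat q = (0::'a)" "q > 1" and e: "(q - 1) dvd e" "e > 0"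
  shows "(\<Sum>x\<in>F. x ^ e) = -1"
proof -
  have fin: "finite F" using F by (intro card_ge_0_finite) simp
  have one: "x ^ e = 1" if "x \<in> F - {0}" for x
  proof -
    have "x * x ^ (q - 1) = x * 1" using that F(4) unfolding F(1) by (simp flip: power_Suc)
    then have "x ^ (q - 1) = 1" using that by (simp only: mult_cancel_left) simp
    then show ?thesis using e by (auto simp: power_mult elim!: dvdE)
  qed
  have "0 \<in> F" using F by simp
  then have "(\<Sum>x\<in>F. x ^ e) = 0 ^ e + (\<Sum>x\<in>F - {0}. x ^ e)" using fin by (simp add: sum.remove)
  also have "(\<Sum>x\<in>F - {0}. x ^ e) = (\<Sum>x\<in>F - {0}. 1)" using one by (intro sum.cong) auto
  also have "\<dots> = of_nat (q - 1)" using fin \<open>0 \<in> F\<close> F(2) by (simp add: card_Diff_singleton)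
  also have "\<dots> = -1" using F(3,4) by (simp add: of_nat_diff)
  finally show ?thesis using e by simp
qed

lemma frobenius_iterate_fixed: "(x::'a::monoid_mult) ^ q = x \<Longrightarrow> x ^ (q ^ n) = x"
  by (induction n) (simp_all add: power_mult mult.commute[of q])

section \<open>The rational function field\<close>

abbreviation const_fract :: "'k::field \<Rightarrow> 'k poly fract" where
  "const_fract c \<equiv> to_fract [:c:]"

abbreviation var_fract :: "'k::field poly fract" where
  "var_fract \<equiv> to_fract [:0, 1:]"

lemma to_fract_power: "to_fract (x ^ n) = to_fract x ^ n"
  by (induction n) auto

lemma CHAR_poly_fract: "CHAR('k::field poly fract) = CHAR('k)"
proof (rule CHAR_eqI)
  have *: "of_nat n = to_fract (of_nat n :: 'k poly)" for n
    by (induction n) auto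
  show "of_nat CHAR('k) = (0 :: 'k poly fract)"
    unfolding * to_fract_eq_0_iff of_nat_eq_0_iff_char_dvd by simp
  show "CHAR('k) dvd n" if "of_nat n = (0 :: 'k poly fract)" for n
    using that unfolding * to_fract_eq_0_iff of_nat_eq_0_iff_char_dvd by simp
qed

lemma var_fract_power_inj: "(var_fract :: 'k::field poly fract) ^ a = var_fract ^ b \<Longrightarrow> a = b"
proof -
  assume "(var_fract :: 'k poly fract) ^ a = var_fract ^ b"
  then have "to_fract ([:0, 1::'k:] ^ a) = to_fract ([:0, 1:] ^ b)" by (simp add: to_fract_power)
  then have "degree ([:0, 1::'k:] ^ a) = degree ([:0, 1::'k:] ^ b)" by simp
  then show "a = b" by (simp add: degree_power_eq)
qed

text \<open>The q constant solutions already exhaust the number of roots that X^q - X can have in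
  the rational function field.\<close>

lemma frobenius_fixed_fract:
  assumes "prime p" "CHAR('k::alg_closed_field) = p" "k > 0" "q = p ^ k"
  shows "{x :: 'k poly fract. x ^ q = x} = const_fract ` {x. x ^ q = x}"
    and "card {x :: 'k poly fract. x ^ q = x} = q"
proof -
  have q: "q > 1" using assms prime_gt_1_nat[of p] by (metis one_less_power)
  define F where "F = {x :: 'k poly fract. x ^ q = x}"
  define P where "P = (monom 1 q + monom (-1) 1 :: 'k poly fract poly)"
  have dP: "degree P = q"
    unfolding P_def using q by (subst degree_add_eq_left) (auto simp: degree_monom_eq)
  then have P0: "P \<noteq> 0" using q by auto
  have F: "F = {x. poly P x = 0}" by (simp add: F_def P_def poly_monom)
  have fin: "finite F" unfolding F by (rule poly_roots_finite[OF P0])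
  have le: "card F \<le> q" using card_poly_roots_bound[OF P0] dP F by simp
  have sub: "const_fract ` {x. x ^ q = x} \<subseteq> F"
    by (auto simp: F_def poly_const_pow simp flip: to_fract_power)
  have inj: "inj_on const_fract A" for A :: "'k set" by (auto simp: inj_on_def)
  have c: "card (const_fract ` {x::'k. x ^ q = x}) = q"
    using card_frobenius_fixed[OF assms(1-3)] assms(4) by (simp add: card_image[OF inj])
  then have eq: "const_fract ` {x. x ^ q = x} = F" using sub le fin c by (intro card_seteq) simp_all
  show "{x :: 'k poly fract. x ^ q = x} = const_fract ` {x. x ^ q = x}" using eq by (simp add: F_def)
  show "card {x :: 'k poly fract. x ^ q = x} = q" using eq c by (simp add: F_def)
qed

text \<open>For 1 <= j <= q - 1, \<open>h j M\<close> is minus the coefficient of x^j in (t + x)^M,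
  viewed as a function of x on F and reduced to degree below q; power sums over F extract it. Its
  vanishing for all j > C bounds this degree by C. The conditions \<open>g z M = 0\<close> fix M
  modulo q - 1.\<close>

lemma zero_locus_power_sums:
  fixes p k C q :: nat
  assumes p: "prime p" "CHAR('k::alg_closed_field) = p" and k: "k > 0" and q: "q = p ^ k" "q \<ge> 3" "2 * C < q"
  shows "zero_locus (geom_seqs :: (nat \<Rightarrow> 'k poly fract) set) (power_sums q C)"
proof -
  let ?B = "geom_seqs :: (nat \<Rightarrow> 'k poly fract) set"
  define F0 where "F0 = {x::'k. x ^ q = x}"
  define F where "F = {x :: 'k poly fract. x ^ q = x}"
  have F0: "card F0 = q" using card_frobenius_fixed[OF p k] q(1) by (simp add: F0_def)
  have q0: "of_nat q = (0::'k)" using p k q by (simp add: of_nat_eq_0_iff_char_dvd)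
  have q0': "of_nat q = (0::'k poly fract)" using p k q by (simp add: of_nat_eq_0_iff_char_dvd CHAR_poly_fract)
  have FF0: "F = const_fract ` F0" and F: "card F = q"
    using frobenius_fixed_fract[OF p k q(1)] by (auto simp: F_def F0_def)
  have fin: "finite F" using F q(2) by (intro card_ge_0_finite) linarith
  have inj: "inj_on const_fract A" for A :: "'k set" by (auto simp: inj_on_def)
  define h where "h j M = (\<Sum>x\<in>F. x ^ (q - 1 - j) * (var_fract + x) ^ M)" for j M
  define g where "g z M = (z ^ M - z ^ C :: 'k poly fract)" for z M
  have nz: "var_fract + x \<noteq> 0" if "x \<in> F" for x
  proof -
    obtain l where "x = const_fract l" using \<open>x \<in> F\<close> FF0 by auto
    then have "var_fract + x = to_fract [:l, 1:]" by (simp flip: to_fract_add)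
    then show ?thesis by simp
  qed
  have "h j \<in> lincomb geom_seqs" for j
    unfolding h_def by (intro lincomb_sum lincomb_base power_in_geom_seqs nz)
  then have h: "zero_locus ?B {M. h j M = 0}" for j by (rule zero_locus_single)
  have "g z \<in> lincomb geom_seqs" if "z \<in> F - {0}" for z
  proof -
    have "(\<lambda>M. 1 * z ^ M + (- (z ^ C)) * 1 ^ M) \<in> lincomb geom_seqs"
      using that by (intro lincomb.step lincomb_base power_in_geom_seqs) auto
    then show ?thesis by (simp add: g_def[abs_def])
  qed
  then have g: "zero_locus ?B {M. g z M = 0}" if "z \<in> F - {0}" for z
    using that by (intro zero_locus_single) auto
  have "power_sums q C =
      {M. \<forall>j\<in>{C<..q - 1}. M \<in> {M. h j M = 0}} \<inter> {M. \<forall>z\<in>F - {0}. M \<in> {M. g z M = 0}}" (is "_ = ?R")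
  proof (intro equalityI subsetI IntI CollectI ballI)
    fix M assume "M \<in> power_sums q C"
    then obtain e where e: "M = (\<Sum>i<C. q ^ e i)" unfolding power_sums_def by auto
    {
      fix z assume "z \<in> F - {0}"
      then have "z ^ M = z ^ C" by (simp add: e power_sum F_def frobenius_iterate_fixed)
      then show "g z M = 0" by (simp add: g_def)
    next
      fix j assume j: "j \<in> {C<..q - 1}"
      \<comment> \<open>On F, (t + x)^(q^n) = t^(q^n) + x, so (t + x)^M agrees there with the
        polynomial \<open>A\<close> of degree at most C.\<close>
      define A where "A = (\<Prod>i<C. [:var_fract ^ (q ^ e i), 1:] :: 'k poly fract poly)"
      have "degree A \<le> (\<Sum>i<C. degree [:var_fract ^ (q ^ e i), 1 :: 'k poly fract:])"
        unfolding A_def by (rule degree_prod_sum_le[unfolded o_def]) auto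
      then have dA: "degree A \<le> C" by simp
      have "(var_fract + x) ^ M = poly A x" if "x \<in> F" for x
      proof -
        have "(var_fract + x) ^ (q ^ n) = var_fract ^ (q ^ n) + x" for n
        proof -
          have "(var_fract + x) ^ (q ^ n) = var_fract ^ (q ^ n) + x ^ (q ^ n)"
            by (rule freshmans_dream'[of _ "k * n"]) (use p q in \<open>auto simp: CHAR_poly_fract power_mult\<close>)
          then show ?thesis using that by (simp add: F_def frobenius_iterate_fixed)
        qed
        then show ?thesis by (simp add: e power_sum A_def poly_prod)
      qed
      then have "h j M = (\<Sum>x\<in>F. x ^ (q - 1 - j) * (\<Sum>l\<le>degree A. coeff A l * x ^ l))"
        unfolding h_def by (simp add: poly_altdef)
      also have "\<dots> = (\<Sum>l\<le>degree A. coeff A l * (\<Sum>x\<in>F. x ^ (q - 1 - j + l)))"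
        unfolding sum_distrib_left by (subst sum.swap) (simp add: power_add mult_ac)
      also have "\<dots> = 0"
      proof (intro sum.neutral ballI)
        \<comment> \<open>Since l <= C < j, the exponent stays below q - 1 and the power sum
          vanishes.\<close>
        fix l assume "l \<in> {..degree A}"
        then have "q - 1 - j + l < q - 1" using dA j q by auto
        from sum_power_frobenius_fixed_0[OF F_def F q0' this]
        show "coeff A l * (\<Sum>x\<in>F. x ^ (q - 1 - j + l)) = 0" by simp
      qed
      finally show "h j M = 0" .
    }
  next
    fix M assume "M \<in> ?R"
    then have hM: "\<And>j. C < j \<Longrightarrow> j \<le> q - 1 \<Longrightarrow> h j M = 0" and gM: "\<And>z. z \<in> F - {0} \<Longrightarrow> g z M = 0"
      by auto
    show "M \<in> power_sums q C"
    proof (rule in_power_sums_if_binomials_vanish[OF p k q])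
      show "M mod (q - 1) = C mod (q - 1)"
      proof (rule ccontr)
        assume ne: "M mod (q - 1) \<noteq> C mod (q - 1)"
        define m where "m = M mod (q - 1)"
        have m: "m < q - 1" using q unfolding m_def by simp
        have C: "C < q - 1" using q by simp
        \<comment> \<open>\<open>B\<close> would be nonzero of degree below q - 1 and yet vanish at
          the q - 1 nonzero elements of F.\<close>
        define B where "B = (monom 1 m - monom 1 C :: 'k poly fract poly)"
        have "coeff B m = 1" using ne C unfolding B_def m_def by (simp add: coeff_monom)
        then have B0: "B \<noteq> 0" by auto
        have dB: "degree B < q - 1"
          unfolding B_def using m C by (intro degree_diff_less) (auto intro: le_less_trans[OF degree_monom_le])
        have "poly B z = 0" if z: "z \<in> F - {0}" for z
        proof -
          have "z * z ^ (q - 1) = z * 1" using z q(2) unfolding F_def by (simp flip: power_Suc)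
          then have z1: "z ^ (q - 1) = 1" using z by (simp only: mult_cancel_left) simp
          have "z ^ M = z ^ ((q - 1) * (M div (q - 1)) + m)" unfolding m_def by simp
          also have "\<dots> = z ^ m" unfolding power_add power_mult z1 by simp
          finally show ?thesis using gM[OF z] by (simp add: B_def g_def poly_monom)
        qed
        then have "card (F - {0}) \<le> card {x. poly B x = 0}"
          by (intro card_mono poly_roots_finite B0) auto
        also have "\<dots> \<le> degree B" by (rule card_poly_roots_bound[OF B0])
        finally have "card (F - {0}) \<le> degree B" .
        moreover have "card (F - {0}) \<ge> q - 1" using F fin by (simp add: card_Diff_singleton_if)
        ultimately show False using dB by linarith
      qed
    next
      fix b assume b: "0 < b" "b \<le> M" "\<not> p dvd (M choose b)"
      show "b mod (q - 1) \<in> {1..C}"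
      proof (rule ccontr)
        assume nb: "b mod (q - 1) \<notin> {1..C}"
        \<comment> \<open>\<open>j\<close> represents b modulo q - 1 in the range from 1 to q - 1.
          Residue 0 is represented by q - 1, so that j > C in that case too.\<close>
        define j where "j = (if b mod (q - 1) = 0 then q - 1 else b mod (q - 1))"
        have bm: "b mod (q - 1) < q - 1" using q by simp
        have j: "C < j" "j \<le> q - 1" using nb q bm unfolding j_def by (auto split: if_splits)
        have jb: "(q - 1) dvd (q - 1 - j + b)"
        proof -
          have "(q - 1 - j + b) mod (q - 1) = (q - 1 - j + b mod (q - 1)) mod (q - 1)"
            by (simp add: mod_add_right_eq)
          also have "\<dots> = 0" using bm by (cases "b mod (q - 1) = 0") (auto simp: j_def)
          finally show ?thesis by auto
        qed
        \<comment> \<open>The coefficient of t^(M - b) in h j M is minus the binomial coefficient of M over b.\<close>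
        have "h j M = (\<Sum>x\<in>F0. const_fract x ^ (q - 1 - j) * (var_fract + const_fract x) ^ M)"
          unfolding h_def FF0 by (simp add: sum.reindex[OF inj])
        also have "\<dots> = to_fract (\<Sum>x\<in>F0. [:x:] ^ (q - 1 - j) * [:x, 1:] ^ M)"
          by (simp add: to_fract_power flip: to_fract_add)
        finally have "to_fract (\<Sum>x\<in>F0. [:x:] ^ (q - 1 - j) * [:x, 1:] ^ M) = 0"
          unfolding hM[OF j] by (rule sym)
        then have "(\<Sum>x\<in>F0. [:x:] ^ (q - 1 - j) * [:x, 1:] ^ M) = 0"
          unfolding to_fract_eq_0_iff .
        then have "0 = coeff (\<Sum>x\<in>F0. [:x:] ^ (q - 1 - j) * [:x, 1:] ^ M) (M - b)" by simp
        also have "\<dots> = (\<Sum>x\<in>F0. x ^ (q - 1 - j) * (of_nat (M choose (M - b)) * x ^ b))"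
          using b by (simp add: coeff_sum poly_const_pow coeff_linear_poly_power)
        also have "\<dots> = of_nat (M choose b) * (\<Sum>x\<in>F0. x ^ (q - 1 - j + b))"
          using b by (simp add: sum_distrib_left power_add mult_ac binomial_symmetric[of b])
        also have "\<dots> = - of_nat (M choose b)"
          by (subst sum_power_frobenius_fixed_dvd[OF F0_def F0 q0 _ jb]) (use q b in auto)
        finally show False using b p of_nat_eq_0_iff_char_dvd[where 'a = 'k, of "M choose b"] by simp
      qed
    qed
  qed
  moreover have "zero_locus ?B ?R"
    by (intro zero_locus_Int zero_locus_Inter h g) (use fin in auto)
  ultimately show ?thesis by simp
qed

section \<open>Weighted sums of powers of q\<close>

text \<open>The point z is arbitrary and the factors are constants \<open>inverse (v - u)\<close>,
  because z will itself be a function of M and the formula must stay within sums and products of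
  such functions.\<close>

lemma lagrange_interpolation:
  fixes A :: "'a::field poly"
  assumes "finite F" "degree A < card F"
  shows "poly A z = (\<Sum>v\<in>F. (\<Prod>u\<in>F - {v}. (z - u) * inverse (v - u)) * poly A v)"
proof -
  define L where "L v = (\<Prod>u\<in>F - {v}. [:- u * inverse (v - u), inverse (v - u):])" for v
  define B where "B = (\<Sum>v\<in>F. smult (poly A v) (L v))"
  have pL: "poly (L v) z = (\<Prod>u\<in>F - {v}. (z - u) * inverse (v - u))" for v z
    unfolding L_def poly_prod by (intro prod.cong) (auto simp: algebra_simps)
  have "degree (L v) < card F" if "v \<in> F" for v
  proof -
    have "degree (L v) \<le> (\<Sum>u\<in>F - {v}. degree [:- u * inverse (v - u), inverse (v - u):])"
      unfolding L_def by (rule degree_prod_sum_le[unfolded o_def]) (use assms in auto)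
    also have "\<dots> \<le> (\<Sum>u\<in>F - {v}. 1)" by (intro sum_mono) (rule degree_pCons_le[THEN le_trans], simp)
    also have "\<dots> < card F" using assms that by (simp add: card_Diff1_less)
    finally show ?thesis .
  qed
  then have dB: "degree B < card F"
    unfolding B_def using assms by (intro degree_sum_less) (auto intro: le_less_trans[OF degree_smult_le])
  have Lw: "poly (L v) w = (if w = v then 1 else 0)" if "v \<in> F" "w \<in> F" for v w
  proof (cases "w = v")
    case True
    have "(v - u) * inverse (v - u) = 1" if "u \<in> F - {v}" for u
      using that by (intro right_inverse) auto
    then show ?thesis unfolding pL True by (simp add: prod.neutral)
  next
    case False
    then show ?thesis unfolding pL using that assms by (auto intro!: prod_zero)
  qed
  have "poly B w = poly A w" if "w \<in> F" for w
  proof -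
    have "poly B w = (\<Sum>v\<in>F. if w = v then poly A v else 0)"
      unfolding B_def poly_sum poly_smult by (intro sum.cong refl) (use Lw that in auto)
    then show ?thesis using that assms by simp
  qed
  then have "B = A" by (rule poly_eqI_degree[of F]) (use dB assms in auto)
  then have "poly A z = poly B z" by simp
  then show ?thesis unfolding B_def by (simp add: poly_sum pL mult.commute)
qed

text \<open>Polynomials in parameters y_j whose coefficients are combinations of sequences g^M. The
  parameters are placeholders for values t^(q^e) that depend on an expansion of M; they are
  eliminated one by one below.\<close>

inductive_set param_comb :: "(nat \<Rightarrow> (nat \<Rightarrow> 'a::field) \<Rightarrow> 'a) set" where
  geom: "g \<noteq> 0 \<Longrightarrow> (\<lambda>M y. a * g ^ M) \<in> param_comb"
| param: "(\<lambda>M y. y j) \<in> param_comb"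
| add: "f \<in> param_comb \<Longrightarrow> g \<in> param_comb \<Longrightarrow> (\<lambda>M y. f M y + g M y) \<in> param_comb"
| mult: "f \<in> param_comb \<Longrightarrow> g \<in> param_comb \<Longrightarrow> (\<lambda>M y. f M y * g M y) \<in> param_comb"

lemma param_comb_const: "(\<lambda>M y. a) \<in> param_comb"
  using param_comb.geom[of 1 a] by simp

lemma param_comb_sum:
  "(\<And>i. i \<in> I \<Longrightarrow> f i \<in> param_comb) \<Longrightarrow> (\<lambda>M y. \<Sum>i\<in>I. f i M y) \<in> param_comb"
  by (induction I rule: infinite_finite_induct) (auto intro: param_comb_const param_comb.add)

lemma param_comb_prod:
  "(\<And>i. i \<in> I \<Longrightarrow> f i \<in> param_comb) \<Longrightarrow> (\<lambda>M y. \<Prod>i\<in>I. f i M y) \<in> param_comb"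
  by (induction I rule: infinite_finite_induct) (auto intro: param_comb_const param_comb.mult)

lemma param_comb_power: "f \<in> param_comb \<Longrightarrow> (\<lambda>M y. f M y ^ n) \<in> param_comb"
  using param_comb_prod[of "{..<n}" "\<lambda>_. f"] by simp

lemma param_comb_specialize:
  assumes "f \<in> param_comb"
  shows "(\<lambda>M. f M y) \<in> lincomb geom_seqs"
  using assms
proof induction
  case (geom g a)
  then show ?case by (intro lincomb_base power_in_geom_seqs)
next
  case (param j)
  show ?case using lincomb_base[OF power_in_geom_seqs[of 1], of "y j"] by simp
next
  case (add f g)
  then show ?case by (intro lincomb_add)
next
  case (mult f g)
  then show ?case by (intro lincomb_mult[OF geom_seqs_mult])
qed

text \<open>The degree bound is uniform in M and y, so that a fixed number of coefficients serves
  for all M when y_j is eliminated.\<close>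

lemma param_comb_as_poly:
  assumes "H \<in> param_comb"
  shows "\<exists>P d. (\<forall>l. (\<lambda>M y. coeff (P M y) l) \<in> param_comb) \<and> (\<forall>M y. degree (P M y) \<le> d) \<and>
           (\<forall>M y v. H M (y(j := v)) = poly (P M y) v)"
  using assms
proof induction
  case (geom g a)
  have "(\<lambda>M y. coeff [:a * g ^ M:] l) \<in> param_comb" for l
    using geom by (cases l) (auto intro: param_comb.geom param_comb_const)
  then show ?case by (intro exI[of _ "\<lambda>M y. [:a * g ^ M:]"] exI[of _ 0]) auto
next
  case (param i)
  have "(\<lambda>M y. coeff (if i = j then [:0, 1:] else [:y i:]) l) \<in> param_comb" for l
    by (cases l; cases "i = j") (auto intro: param_comb.param param_comb_const)
  then show ?case
    by (intro exI[of _ "\<lambda>M y. if i = j then [:0, 1:] else [:y i:]"] exI[of _ 1]) auto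
next
  case (add f g)
  then obtain P d Q e where P: "\<And>l. (\<lambda>M y. coeff (P M y) l) \<in> param_comb" "\<And>M y. degree (P M y) \<le> d"
      "\<And>M y v. f M (y(j := v)) = poly (P M y) v"
    and Q: "\<And>l. (\<lambda>M y. coeff (Q M y) l) \<in> param_comb" "\<And>M y. degree (Q M y) \<le> e"
      "\<And>M y v. g M (y(j := v)) = poly (Q M y) v" by blast
  show ?case
    by (intro exI[of _ "\<lambda>M y. P M y + Q M y"] exI[of _ "max d e"])
       (use P Q in \<open>auto simp: fun_upd_def intro!: param_comb.add degree_add_le intro: max.coboundedI1 max.coboundedI2\<close>)
next
  case (mult f g)
  then obtain P d Q e where P: "\<And>l. (\<lambda>M y. coeff (P M y) l) \<in> param_comb" "\<And>M y. degree (P M y) \<le> d"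
      "\<And>M y v. f M (y(j := v)) = poly (P M y) v"
    and Q: "\<And>l. (\<lambda>M y. coeff (Q M y) l) \<in> param_comb" "\<And>M y. degree (Q M y) \<le> e"
      "\<And>M y v. g M (y(j := v)) = poly (Q M y) v" by blast
  show ?case
    by (intro exI[of _ "\<lambda>M y. P M y * Q M y"] exI[of _ "d + e"])
       (use P Q in \<open>auto simp: coeff_mult fun_upd_def intro!: param_comb_sum param_comb.mult degree_mult_le[THEN le_trans] add_mono\<close>)
qed

section \<open>Eliminating parameters by products over the powers of q in M\<close>

locale frobenius_setting =
  fixes p k q :: nat and F :: "'a::field set" and t :: 'a
  assumes prime: "prime p" "CHAR('a) = p"
    and q: "q = p ^ k"
    and F: "F = {x. x ^ q = x}" "card F = q"
    and t: "t \<noteq> 0" "\<And>a b. t ^ a = t ^ b \<Longrightarrow> a = b"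
begin

lemma q_pos: "q > 0"
  using prime q by (simp add: prime_gt_0_nat)

lemma finite_F: "finite F"
  using F(2) q_pos by (intro card_ge_0_finite) simp

lemma frobenius_add: "((x::'a) + y) ^ (q ^ n) = x ^ (q ^ n) + y ^ (q ^ n)"
  by (rule freshmans_dream'[of _ "k * n"]) (use prime q in \<open>auto simp: power_mult\<close>)

text \<open>
  Induction on d replaces the last coefficient by its q interpolation nodes v, which fuse with G
  because (G + v t^d)^(q^n) = G^(q^n) + v (t^(q^n))^d.
\<close>
lemma param_comb_norm_sum:
  assumes C: "C < q" and D: "\<And>M. M \<in> D \<Longrightarrow> M = (\<Sum>i<C. q ^ e M i)"
    and h: "\<And>l. l < d \<Longrightarrow> h l \<in> param_comb"
  shows "\<exists>H\<in>param_comb. \<forall>M\<in>D. \<forall>y.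
           H M y = (\<Prod>i<C. G ^ (q ^ e M i) + (\<Sum>l<d. h l M y * (t ^ (q ^ e M i)) ^ l))"
  using h
proof (induction d arbitrary: G)
  case 0
  \<comment> \<open>Without coefficients the product is G^M. The case G = 0 is separate because
    geometric sequences have a nonzero base; it gives 0^C, which is 1 for C = 0.\<close>
  show ?case
  proof (cases "G = 0")
    case True
    have "(0 :: 'a) ^ (q ^ n) = 0" for n using q_pos by simp
    then have "(\<Prod>i<C. (0 :: 'a) ^ (q ^ e M i)) = (\<Prod>i<C. 0)" for M by (intro prod.cong refl)
    then have "0 ^ C = (\<Prod>i<C. (0 :: 'a) ^ (q ^ e M i))" for M by (simp only: prod_constant card_lessThan)
    then show ?thesis using True
      by (intro bexI[of _ "\<lambda>M y. 0 ^ C"]) (auto intro: param_comb_const)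
  next
    case False
    have "G ^ M = (\<Prod>i<C. G ^ (q ^ e M i))" if "M \<in> D" for M
      using D[OF that] by (metis power_sum)
    then show ?thesis
      using param_comb.geom[OF False, of 1] by (intro bexI[of _ "\<lambda>M y. G ^ M"]) auto
  qed
next
  case (Suc d)
  have "\<forall>v. \<exists>H. H \<in> param_comb \<and> (\<forall>M\<in>D. \<forall>y. H M y =
    (\<Prod>i<C. (G + v * t ^ d) ^ (q ^ e M i) + (\<Sum>l<d. h l M y * (t ^ (q ^ e M i)) ^ l)))"
    using Suc.IH[OF Suc.prems[OF less_SucI]] by (intro allI) (simp only: Bex_def)
  from choice[OF this] obtain H where H0: "\<forall>v. H v \<in> param_comb \<and> (\<forall>M\<in>D. \<forall>y. H v M y =
    (\<Prod>i<C. (G + v * t ^ d) ^ (q ^ e M i) + (\<Sum>l<d. h l M y * (t ^ (q ^ e M i)) ^ l)))" by (elim exE)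
  then have H: "H v \<in> param_comb" for v by (elim allE conjE)
  have Hv: "H v M y = (\<Prod>i<C. (G + v * t ^ d) ^ (q ^ e M i) + (\<Sum>l<d. h l M y * (t ^ (q ^ e M i)) ^ l))"
    if "M \<in> D" for v M y
    using H0 that by (elim allE[of _ v] conjE ballE[of _ _ M] allE[of _ y]) auto
  \<comment> \<open>\<open>K\<close> interpolates at the last coefficient \<open>h d M y\<close>,
    from the values \<open>H v M y\<close> at the q nodes v in F.\<close>
  define K where "K M y = (\<Sum>v\<in>F. (\<Prod>u\<in>F - {v}. (h d M y + (- u)) * inverse (v - u)) * H v M y)" for M y
  have "K \<in> param_comb"
    unfolding K_def[abs_def]
    by (intro param_comb_sum param_comb.mult param_comb_prod param_comb.add param_comb_const H Suc.prems) simp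
  moreover have "K M y = (\<Prod>i<C. G ^ (q ^ e M i) + (\<Sum>l<Suc d. h l M y * (t ^ (q ^ e M i)) ^ l))"
    if M: "M \<in> D" for M y
  proof -
    \<comment> \<open>In \<open>A\<close> the last coefficient is an unknown z. Its degree is at
      most C < q, so q nodes determine it.\<close>
    define A where "A = (\<Prod>i<C. [:G ^ (q ^ e M i) + (\<Sum>l<d. h l M y * (t ^ (q ^ e M i)) ^ l), (t ^ (q ^ e M i)) ^ d:])"
    have "degree A \<le> (\<Sum>i<C. degree [:G ^ (q ^ e M i) + (\<Sum>l<d. h l M y * (t ^ (q ^ e M i)) ^ l), (t ^ (q ^ e M i)) ^ d:])"
      unfolding A_def by (rule degree_prod_sum_le[unfolded o_def]) auto
    also have "\<dots> \<le> (\<Sum>i<C. 1)" by (intro sum_mono) (rule degree_pCons_le[THEN le_trans], simp)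
    finally have dA: "degree A < card F" using C F by simp
    have A: "poly A z = (\<Prod>i<C. G ^ (q ^ e M i) + (\<Sum>l<d. h l M y * (t ^ (q ^ e M i)) ^ l) + z * (t ^ (q ^ e M i)) ^ d)" for z
      by (simp add: A_def poly_prod)
    have "H v M y = poly A v" if "v \<in> F" for v
    proof -
      have "(G + v * t ^ d) ^ (q ^ n) = G ^ (q ^ n) + v * (t ^ (q ^ n)) ^ d" for n
        using that by (simp add: frobenius_add F(1) frobenius_iterate_fixed power_mult_distrib
            mult.commute flip: power_mult)
      then show ?thesis unfolding Hv[OF M] A by (intro prod.cong refl) (simp add: add_ac)
    qed
    then have "K M y = (\<Sum>v\<in>F. (\<Prod>u\<in>F - {v}. (h d M y - u) * inverse (v - u)) * poly A v)"
      unfolding K_def by (intro sum.cong refl) simp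
    also have "\<dots> = poly A (h d M y)" by (rule lagrange_interpolation[OF finite_F dA, symmetric])
    finally show ?thesis by (simp add: A add.assoc)
  qed
  ultimately show ?case by blast
qed

text \<open>Expanding in powers of y_j brings each factor into the shape treated by
  \<open>param_comb_norm_sum\<close>, with G = 0.\<close>

lemma param_comb_norm:
  assumes C: "C < q" and D: "\<And>M. M \<in> D \<Longrightarrow> M = (\<Sum>i<C. q ^ e M i)" and H: "H \<in> param_comb"
  shows "\<exists>H'\<in>param_comb. \<forall>M\<in>D. \<forall>y. H' M y = (\<Prod>i<C. H M (y(j := t ^ (q ^ e M i))))"
proof -
  from param_comb_as_poly[OF H, of j] obtain P d where
    P: "\<And>l. (\<lambda>M y. coeff (P M y) l) \<in> param_comb" "\<And>M y. degree (P M y) \<le> d"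
      "\<And>M y v. H M (y(j := v)) = poly (P M y) v" by blast
  \<comment> \<open>The term 0^(q^n) is 0; it plays the part of G^(q^n).\<close>
  have "poly (P M y) v = 0 ^ (q ^ n) + (\<Sum>l<Suc d. coeff (P M y) l * v ^ l)" for M y v n
    using poly_as_sum_of_monoms'[OF P(2)] q_pos
    by (simp add: poly_altdef lessThan_Suc_atMost sum.mono_neutral_left[of "{..d}" "{..degree (P M y)}"] P(2) coeff_eq_0)
  then have "H M (y(j := t ^ (q ^ e M i))) =
    0 ^ (q ^ e M i) + (\<Sum>l<Suc d. coeff (P M y) l * (t ^ (q ^ e M i)) ^ l)" for M y i
    unfolding P(3) .
  then show ?thesis
    using param_comb_norm_sum[OF C D, where d = "Suc d" and h = "\<lambda>l M y. coeff (P M y) l" and G = 0] P(1) by simp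
qed

text \<open>A product vanishes iff one of its factors does, so successive products over the values
  of each parameter encode the existence of an assignment f in one equation.\<close>

lemma param_comb_norm_iterated:
  assumes C: "C < q" and D: "\<And>M. M \<in> D \<Longrightarrow> M = (\<Sum>i<C. q ^ e M i)" and H: "H \<in> param_comb"
    and "finite J"
  shows "\<exists>H'\<in>param_comb. \<forall>M\<in>D. \<forall>y. H' M y = 0 \<longleftrightarrow>
    (\<exists>f. (\<forall>j\<in>J. f j < C) \<and> H M (\<lambda>j. if j \<in> J then t ^ (q ^ e M (f j)) else y j) = 0)"
  using \<open>finite J\<close>
proof induction
  case empty
  show ?case using H by auto
next
  case (insert a J)
  then obtain H' where H': "H' \<in> param_comb" "\<And>M y. M \<in> D \<Longrightarrow> H' M y = 0 \<longleftrightarrow>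
    (\<exists>f. (\<forall>j\<in>J. f j < C) \<and> H M (\<lambda>j. if j \<in> J then t ^ (q ^ e M (f j)) else y j) = 0)" by blast
  have "\<exists>K\<in>param_comb. \<forall>M\<in>D. \<forall>y. K M y = (\<Prod>i<C. H' M (y(a := t ^ (q ^ e M i))))"
    by (rule param_comb_norm[OF C D H'(1)])
  then obtain K where K: "K \<in> param_comb"
    "\<And>M y. M \<in> D \<Longrightarrow> K M y = (\<Prod>i<C. H' M (y(a := t ^ (q ^ e M i))))" by blast
  have "K M y = 0 \<longleftrightarrow> (\<exists>f. (\<forall>j\<in>insert a J. f j < C) \<and>
      H M (\<lambda>j. if j \<in> insert a J then t ^ (q ^ e M (f j)) else y j) = 0)" if M: "M \<in> D" for M y
  proof -
    have "K M y = 0 \<longleftrightarrow> (\<exists>i<C. \<exists>f. (\<forall>j\<in>J. f j < C) \<and>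
        H M (\<lambda>j. if j \<in> J then t ^ (q ^ e M (f j)) else (y(a := t ^ (q ^ e M i))) j) = 0)"
      unfolding K(2)[OF M] H'(2)[OF M, symmetric] by (auto simp: fun_upd_def)
    also have "\<dots> \<longleftrightarrow> (\<exists>f. (\<forall>j\<in>insert a J. f j < C) \<and>
        H M (\<lambda>j. if j \<in> insert a J then t ^ (q ^ e M (f j)) else y j) = 0)" (is "?L \<longleftrightarrow> ?R")
    proof
      assume ?L
      then obtain i f where f: "i < C" "\<forall>j\<in>J. f j < C"
        "H M (\<lambda>j. if j \<in> J then t ^ (q ^ e M (f j)) else (y(a := t ^ (q ^ e M i))) j) = 0" by blast
      moreover have "(\<lambda>j. if j \<in> J then t ^ (q ^ e M (f j)) else (y(a := t ^ (q ^ e M i))) j) =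
        (\<lambda>j. if j \<in> insert a J then t ^ (q ^ e M ((f(a := i)) j)) else y j)"
        using insert.hyps by (auto simp: fun_eq_iff)
      ultimately show ?R by (intro exI[of _ "f(a := i)"]) auto
    next
      assume ?R
      then obtain f where f: "\<forall>j\<in>insert a J. f j < C"
        "H M (\<lambda>j. if j \<in> insert a J then t ^ (q ^ e M (f j)) else y j) = 0" by blast
      moreover have "(\<lambda>j. if j \<in> insert a J then t ^ (q ^ e M (f j)) else y j) =
        (\<lambda>j. if j \<in> J then t ^ (q ^ e M (f j)) else (y(a := t ^ (q ^ e M (f a)))) j)"
        using insert.hyps by (auto simp: fun_eq_iff)
      ultimately show ?L by (intro exI[of _ "f a"]) auto
    qed
    finally show ?thesis .
  qed
  then show ?case using K(1) by blast
qed

text \<open>Repeat q^(n_j) exactly c_j times. A positive c_j makes n_j occur in the list of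
  exponents, so that an assignment can point to it.\<close>

lemma weighted_power_sum_expand:
  assumes "finite J"
  shows "\<exists>e. (\<Sum>j\<in>J. c j * q ^ n j) = (\<Sum>i<(\<Sum>j\<in>J. c j). q ^ e i) \<and>
    (\<forall>j\<in>J. c j > 0 \<longrightarrow> (\<exists>i<(\<Sum>j\<in>J. c j). e i = n j))"
  using assms
proof induction
  case empty
  show ?case by simp
next
  case (insert a J)
  define w where "w = (\<Sum>j\<in>J. c j)"
  from insert obtain e where e: "(\<Sum>j\<in>J. c j * q ^ n j) = (\<Sum>i<w. q ^ e i)"
    "\<forall>j\<in>J. c j > 0 \<longrightarrow> (\<exists>i<w. e i = n j)" unfolding w_def by blast
  define e' where "e' i = (if i < w then e i else n a)" for i
  have "(\<Sum>i<w + v. q ^ e' i) = (\<Sum>i<w. q ^ e i) + v * q ^ n a" for v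
    by (induction v) (auto simp: e'_def)
  moreover have "\<exists>i<w + c a. e' i = n j" if "j \<in> J" "c j > 0" for j
    using e(2) that unfolding e'_def by (metis trans_less_add1)
  moreover have "\<exists>i<w + c a. e' i = n a" if "c a > 0"
    using that unfolding e'_def by (intro exI[of _ w]) auto
  ultimately show ?case
    using insert.hyps e(1) by (intro exI[of _ e']) (auto simp: w_def[symmetric] add.commute[of "c a"])
qed

lemma zero_locus_weighted_power_sums:
  fixes c :: "nat \<Rightarrow> nat"
  assumes J: "finite J" "\<And>j. j \<in> J \<Longrightarrow> c j > 0" and Cq: "(\<Sum>j\<in>J. c j) < q"
    and loc: "zero_locus (geom_seqs :: (nat \<Rightarrow> 'a) set) (power_sums q (\<Sum>j\<in>J. c j))"
  shows "zero_locus (geom_seqs :: (nat \<Rightarrow> 'a) set) {\<Sum>j\<in>J. c j * q ^ n j | n. True}"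
proof -
  define C where "C = (\<Sum>j\<in>J. c j)"
  define D where "D = power_sums q C"
  define S where "S = {\<Sum>j\<in>J. c j * q ^ n j | n. True}"
  \<comment> \<open>The expansion of M is chosen with S in view: for M in S it contains all
    exponents of some weighted representation, so a suitable assignment exists later.\<close>
  have ex: "\<exists>e. M = (\<Sum>i<C. q ^ e i) \<and> (M \<in> S \<longrightarrow> (\<exists>n. M = (\<Sum>j\<in>J. c j * q ^ n j) \<and> (\<forall>j\<in>J. \<exists>i<C. e i = n j)))"
    if "M \<in> D \<or> M \<in> S" for M
  proof (cases "M \<in> S")
    case True
    then obtain n where n: "M = (\<Sum>j\<in>J. c j * q ^ n j)" unfolding S_def by auto
    from weighted_power_sum_expand[OF J(1), of c n] obtain e where
      "(\<Sum>j\<in>J. c j * q ^ n j) = (\<Sum>i<C. q ^ e i)" "\<forall>j\<in>J. c j > 0 \<longrightarrow> (\<exists>i<C. e i = n j)"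
      unfolding C_def by blast
    then show ?thesis using J(2) n by (intro exI[of _ e] conjI impI exI[of _ n]) auto
  next
    case False
    then show ?thesis using that unfolding D_def power_sums_def by auto
  qed
  then have SD: "S \<subseteq> D" unfolding D_def power_sums_def by blast
  have "\<forall>M\<in>D. \<exists>e. M = (\<Sum>i<C. q ^ e i) \<and>
      (M \<in> S \<longrightarrow> (\<exists>n. M = (\<Sum>j\<in>J. c j * q ^ n j) \<and> (\<forall>j\<in>J. \<exists>i<C. e i = n j)))"
    by (intro ballI ex disjI1)
  from bchoice[OF this] obtain e where *: "\<forall>M\<in>D. M = (\<Sum>i<C. q ^ e M i) \<and>
      (M \<in> S \<longrightarrow> (\<exists>n. M = (\<Sum>j\<in>J. c j * q ^ n j) \<and> (\<forall>j\<in>J. \<exists>i<C. e M i = n j)))"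
    by (elim exE)
  have e: "M = (\<Sum>i<C. q ^ e M i)" if "M \<in> D" for M
    using bspec[OF * that] by (rule conjunct1)
  have eS: "\<exists>n. M = (\<Sum>j\<in>J. c j * q ^ n j) \<and> (\<forall>j\<in>J. \<exists>i<C. e M i = n j)" if M: "M \<in> S" for M
    using bspec[OF * subsetD[OF SD M]] M by (elim conjE) (rule mp)
  \<comment> \<open>Once each y_j is replaced by t^(q^(e M (f j))), \<open>H\<close> vanishes iff M
    is the weighted sum belonging to f, because powers of t determine their exponents.\<close>
  define H where "H M y = 1 * t ^ M + (-1) * (\<Prod>j\<in>J. y j ^ c j)" for M y
  have "(\<lambda>M y. \<Prod>j\<in>J. y j ^ c j :: 'a) \<in> param_comb"
    by (intro param_comb_prod param_comb_power param_comb.param)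
  then have "H \<in> param_comb"
    unfolding H_def[abs_def] using t
    by (intro param_comb.add param_comb.geom param_comb.mult[OF param_comb_const])
  have "\<exists>H'\<in>param_comb. \<forall>M\<in>D. \<forall>y. H' M y = 0 \<longleftrightarrow>
      (\<exists>f. (\<forall>j\<in>J. f j < C) \<and> H M (\<lambda>j. if j \<in> J then t ^ (q ^ e M (f j)) else y j) = 0)"
    by (rule param_comb_norm_iterated[OF Cq[folded C_def] e \<open>H \<in> param_comb\<close> J(1)])
  then obtain H' where H': "H' \<in> param_comb" and H'0: "\<forall>M\<in>D. \<forall>y. H' M y = 0 \<longleftrightarrow>
      (\<exists>f. (\<forall>j\<in>J. f j < C) \<and> H M (\<lambda>j. if j \<in> J then t ^ (q ^ e M (f j)) else y j) = 0)"
    by (elim bexE)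
  have Hz: "H M (\<lambda>j. if j \<in> J then t ^ (q ^ e M (f j)) else y j) = 0 \<longleftrightarrow>
      M = (\<Sum>j\<in>J. c j * q ^ e M (f j))" for M f y
  proof -
    have "(\<Prod>j\<in>J. (if j \<in> J then t ^ (q ^ e M (f j)) else y j) ^ c j) = (\<Prod>j\<in>J. t ^ (c j * q ^ e M (f j)))"
      by (intro prod.cong) (auto simp: mult.commute simp flip: power_mult)
    then show ?thesis using t(2) by (auto simp: H_def simp flip: power_sum)
  qed
  have H'_iff: "H' M y = 0 \<longleftrightarrow> (\<exists>f. (\<forall>j\<in>J. f j < C) \<and> M = (\<Sum>j\<in>J. c j * q ^ e M (f j)))"
    if "M \<in> D" for M y
    using H'0 that unfolding Hz by (elim ballE allE[of _ y]) auto
  have "S = D \<inter> {M. H' M (\<lambda>_. 0) = 0}"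
  proof (intro equalityI subsetI IntI CollectI)
    fix M assume M: "M \<in> S"
    then show "M \<in> D" using SD by auto
    from eS[OF M] obtain n where n: "M = (\<Sum>j\<in>J. c j * q ^ n j)" "\<forall>j\<in>J. \<exists>i<C. e M i = n j"
      by (elim exE conjE)
    from bchoice[OF n(2)] obtain f where f: "\<forall>j\<in>J. f j < C \<and> e M (f j) = n j" by (elim exE)
    then have "M = (\<Sum>j\<in>J. c j * q ^ e M (f j))" unfolding n(1) by (intro sum.cong) auto
    then show "H' M (\<lambda>_. 0) = 0" unfolding H'_iff[OF \<open>M \<in> D\<close>] using f by (intro exI[of _ f]) simp
  next
    fix M assume M: "M \<in> D \<inter> {M. H' M (\<lambda>_. 0) = 0}"
    then have "H' M (\<lambda>_. 0) = 0" "M \<in> D" by auto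
    then obtain f where "M = (\<Sum>j\<in>J. c j * q ^ e M (f j))" using H'_iff by auto
    then show "M \<in> S" unfolding S_def by (intro CollectI exI[of _ "\<lambda>j. e M (f j)"]) simp
  qed
  moreover have "zero_locus (geom_seqs :: (nat \<Rightarrow> 'a) set) (D \<inter> {M. H' M (\<lambda>_. 0) = 0})"
    by (rule zero_locus_Int[OF loc[folded C_def D_def] zero_locus_single[OF param_comb_specialize[OF H']]])
  ultimately show ?thesis unfolding S_def by simp
qed

end

section \<open>p-sets and arithmetic progressions\<close>

text \<open>Raising n by P raises the quotient by D; from n >= b on the quotient is nonnegative and
  \<open>nat\<close> loses nothing.\<close>

lemma floor_power_in_orbit_seqs:
  fixes g :: "'a::field"
  assumes "g \<noteq> 0" "D > 0" "P > 0"
  shows "(\<lambda>n. g ^ nat ((int D * int n - b) div int P)) \<in> orbit_seqs"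
proof (rule orbit_seqsI[of _ "g ^ D" P "nat b"])
  fix n assume n: "nat b \<le> n"
  have "int n \<le> int D * int n" using assms by (simp add: mult_le_cancel_right1)
  then have "b \<le> int D * int n" using n by linarith
  then have "(int D * int n - b) div int P \<ge> 0" using assms by (simp add: pos_imp_zdiv_nonneg_iff)
  moreover have eq: "int D * int (n + P) - b = (int D * int n - b) + int D * int P"
    by (simp add: algebra_simps)
  have "(int D * int (n + P) - b) div int P = (int D * int n - b) div int P + int D"
    unfolding eq using assms by (subst div_mult_self1) auto
  ultimately show "g ^ nat ((int D * int (n + P) - b) div int P) =
      g ^ D * g ^ nat ((int D * int n - b) div int P)"
    by (simp add: nat_add_distrib power_add mult.commute)
qed (use assms in auto)

lemma var_fract_neq: "(var_fract :: 'k::field poly fract) \<noteq> 0" "(var_fract :: 'k poly fract) \<noteq> 1"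
  using var_fract_power_inj[of 1 0] by auto

text \<open>Solve for the power sum: M = (D n - b) / p^l. Geometric sequences in M become orbit
  sequences in n, and exactness of the division with a nonnegative quotient is an eventually
  periodic condition on n.\<close>

lemma zero_locus_affine_power_sum:
  fixes c :: "nat \<Rightarrow> nat"
  assumes p: "prime p" "CHAR('k::alg_closed_field) = p" and "N > 0" and qN: "q = p ^ N" "q \<ge> 3"
    and J: "finite J" "\<And>j. j \<in> J \<Longrightarrow> c j > 0" "2 * (\<Sum>j\<in>J. c j) < q" and "D > 0"
  shows "zero_locus (orbit_seqs :: (nat \<Rightarrow> 'k poly fract) set)
     {n. \<exists>\<nu>. int D * int n = b + int (p ^ l) * (\<Sum>j\<in>J. int (c j) * int q ^ \<nu> j)}"
proof -
  let ?B = "orbit_seqs :: (nat \<Rightarrow> 'k poly fract) set"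
  define P where "P = p ^ l"
  have P: "P > 0" using p by (simp add: P_def prime_gt_0_nat)
  define S where "S = {\<Sum>j\<in>J. c j * q ^ n j | n. True}"
  define M where "M n = nat ((int D * int n - b) div int P)" for n
  define Z where "Z = {n. b \<le> int D * int n \<and> int P dvd (int D * int n - b)}"
  interpret frobenius_setting p N q "{x :: 'k poly fract. x ^ q = x}" var_fract
    using p qN frobenius_fixed_fract(2)[OF p \<open>N > 0\<close> qN(1)] var_fract_power_inj var_fract_neq(1)
    by unfold_locales (auto simp: CHAR_poly_fract)
  have "zero_locus (geom_seqs :: (nat \<Rightarrow> 'k poly fract) set) (power_sums q (\<Sum>j\<in>J. c j))"
    by (rule zero_locus_power_sums[OF p \<open>N > 0\<close> qN J(3)])
  then have "zero_locus (geom_seqs :: (nat \<Rightarrow> 'k poly fract) set) S"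
    unfolding S_def using J by (intro zero_locus_weighted_power_sums) auto
  then have "zero_locus ?B (M -` S)"
    by (rule zero_locus_vimage[rotated])
       (auto simp: geom_seqs_def M_def intro!: floor_power_in_orbit_seqs P \<open>D > 0\<close>)
  moreover have "zero_locus ?B Z"
  proof (rule zero_locus_eventually_periodic[OF P, of "nat b" Z var_fract])
    fix n assume n: "nat b \<le> n"
    have "int n \<le> int D * int n" using \<open>D > 0\<close> by (simp add: mult_le_cancel_right1)
    then have "b \<le> int D * int n" using n by linarith
    moreover have "int D * int n \<le> int D * int (n + P)" by (simp add: mult_left_mono)
    moreover have eq: "int D * int (n + P) - b = (int D * int n - b) + int D * int P"
      by (simp add: algebra_simps)
    have "int P dvd (int D * int (n + P) - b) \<longleftrightarrow> int P dvd (int D * int n - b)"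
      unfolding eq by (rule dvd_add_times_triv_right_iff)
    ultimately show "n + P \<in> Z \<longleftrightarrow> n \<in> Z"
      unfolding Z_def mem_Collect_eq by linarith
  qed (rule var_fract_neq)+
  ultimately have "zero_locus ?B (M -` S \<inter> Z)" by (rule zero_locus_Int)
  moreover have "M -` S \<inter> Z =
    {n. \<exists>\<nu>. int D * int n = b + int (p ^ l) * (\<Sum>j\<in>J. int (c j) * int q ^ \<nu> j)}"
  proof (intro equalityI subsetI IntI CollectI vimageI2)
    fix n assume "n \<in> M -` S \<inter> Z"
    then obtain \<nu> where \<nu>: "M n = (\<Sum>j\<in>J. c j * q ^ \<nu> j)" and n: "b \<le> int D * int n" "int P dvd (int D * int n - b)"
      unfolding S_def Z_def by auto
    have "int D * int n - b = int P * ((int D * int n - b) div int P)" using n by simp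
    also have "(int D * int n - b) div int P = int (M n)"
      using n P by (simp add: M_def pos_imp_zdiv_nonneg_iff)
    finally show "\<exists>\<nu>. int D * int n = b + int (p ^ l) * (\<Sum>j\<in>J. int (c j) * int q ^ \<nu> j)"
      unfolding \<nu> P_def[symmetric] by (intro exI[of _ \<nu>]) simp
  next
    fix n assume "n \<in> {n. \<exists>\<nu>. int D * int n = b + int (p ^ l) * (\<Sum>j\<in>J. int (c j) * int q ^ \<nu> j)}"
    then obtain \<nu> where "int D * int n = b + int P * (\<Sum>j\<in>J. int (c j) * int q ^ \<nu> j)"
      unfolding P_def by auto
    then have n: "int D * int n - b = int P * int (\<Sum>j\<in>J. c j * q ^ \<nu> j)" by simp
    then have "M n = (\<Sum>j\<in>J. c j * q ^ \<nu> j)" unfolding M_def using P by (simp del: of_nat_sum)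
    then show "M n \<in> S" unfolding S_def by auto
    have "int P * int (\<Sum>j\<in>J. c j * q ^ \<nu> j) \<ge> 0"
      by (simp only: of_nat_mult[symmetric] of_nat_0_le_iff)
    then have "b \<le> int D * int n" using n by linarith
    moreover have "int P dvd (int D * int n - b)" unfolding n by (rule dvd_triv_left)
    ultimately show "n \<in> Z" unfolding Z_def by simp
  qed
  ultimately show ?thesis by simp
qed

text \<open>
  If no exponent lies in the window [i w, i w + w) mod N, then the large exponents are those of
  p^(i w + w) times a number p^r q^s with r < N - w, so that coefficients small against p^w
  become coefficients small against q = p^N.
\<close>
lemma window_decomposition:
  fixes i w N E :: nat
  assumes "w > 0" "(i + 1) * w \<le> N" "(E mod N) div w \<noteq> i" "E \<ge> i * w"
  shows "\<exists>r s. E = r + N * s \<and> i * w + w \<le> r \<and> r < i * w + N"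
proof -
  have iw: "i * w + w \<le> N" using assms(2) by simp
  have win: "x div w = i" if "i * w \<le> x" "x < i * w + w" for x
    using that by (intro div_nat_eqI) (auto simp: mult.commute)
  have "E \<ge> i * w + w"
  proof (rule ccontr)
    assume "\<not> ?thesis"
    then have "E < i * w + w" by simp
    then show False using win[of E] assms iw by simp
  qed
  define r where "r = (E - (i * w + w)) mod N"
  define s where "s = (E - (i * w + w)) div N"
  have E: "E = i * w + w + r + N * s"
    using \<open>E \<ge> i * w + w\<close> mult_div_mod_eq[of N "E - (i * w + w)"] unfolding r_def s_def by linarith
  have "r < N" using iw assms(1) unfolding r_def by simp
  \<comment> \<open>If w + r >= N, then E would be congruent modulo N to a point x of the excluded
    window.\<close>
  have "w + r < N"
  proof (rule ccontr)
    assume n: "\<not> ?thesis"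
    define x where "x = i * w + (w + r - N)"
    have "E = x + N * (s + 1)" using E n unfolding x_def by simp
    moreover have x: "i * w \<le> x" "x < i * w + w" using \<open>r < N\<close> n unfolding x_def by auto
    moreover have "x < N" using x iw by simp
    ultimately have "E mod N = x" by (metis mod_less mod_mult_self2)
    then show False using win[OF x] assms by simp
  qed
  then show ?thesis using E by (intro exI[of _ "i * w + w + r"] exI[of _ s]) auto
qed

text \<open>Take m + 1 disjoint windows of length w among the residues modulo N. By pigeonhole the
  at most m varying exponents miss one of them. Exponents below the free window are frozen, the
  others vary as r + N s. This leaves finitely many cases, each an affine image of a power sum with
  coefficients small against q = p^N.\<close>

lemma zero_locus_int_power_sum:
  fixes a :: "nat \<Rightarrow> int" and kk :: "nat \<Rightarrow> nat"
  assumes p: "prime p" "CHAR('k::alg_closed_field) = p" and D: "D > 0"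
    and pos: "\<And>j. j < m \<Longrightarrow> kk j > 0 \<Longrightarrow> a j > 0"
  shows "zero_locus (orbit_seqs :: (nat \<Rightarrow> 'k poly fract) set)
     {n. \<exists>\<nu>. int D * int n = (\<Sum>j<m. a j * int p ^ (kk j * \<nu> j))}"
proof -
  let ?B = "orbit_seqs :: (nat \<Rightarrow> 'k poly fract) set"
  define J where "J = {j. j < m \<and> kk j > 0}"
  have J: "finite J" "J \<subseteq> {..<m}" "\<And>j. j \<in> J \<Longrightarrow> kk j > 0" "\<And>j. j \<in> J \<Longrightarrow> a j > 0"
    using pos by (auto simp: J_def)
  define A where "A = (\<Sum>j\<in>J. nat (a j))"
  \<comment> \<open>This length ensures 2 A < p^w.\<close>
  define w where "w = 2 * A + 2"
  define \<kappa> where "\<kappa> = (\<Prod>j\<in>J. kk j)"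
  \<comment> \<open>\<open>N\<close> has room for m + 1 windows and is a multiple of every
    \<open>kk j\<close> with j in J, so adding multiples of N keeps an exponent divisible by
    \<open>kk j\<close>.\<close>
  define N where "N = \<kappa> * ((m + 1) * w)"
  define q where "q = p ^ N"
  have \<kappa>: "\<kappa> > 0" unfolding \<kappa>_def using J by (intro prod_pos) auto
  have kN: "kk j dvd N" if "j \<in> J" for j
    using that J unfolding N_def \<kappa>_def by (intro dvd_mult2 dvd_prodI) auto
  have Nw: "(m + 1) * w \<le> N" unfolding N_def using \<kappa> by simp
  have wN: "w \<le> N" using Nw by simp
  have w: "w > 0" "w \<ge> 2" unfolding w_def by auto
  have p2: "p \<ge> 2" using p prime_ge_2_nat by blast
  have "w < 2 ^ w" by (rule less_exp)
  also have "(2::nat) ^ w \<le> p ^ w" using p2 by (intro power_mono) auto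
  finally have pw: "2 * A < p ^ w" unfolding w_def by simp
  have "(2::nat) ^ 2 \<le> 2 ^ N" using w wN by (intro power_increasing) auto
  also have "(2::nat) ^ N \<le> p ^ N" using p2 by (intro power_mono) auto
  finally have q3: "q \<ge> 3" unfolding q_def by simp
  \<comment> \<open>The terms with \<open>kk j = 0\<close> are constant and may have any
    sign.\<close>
  define a0 where "a0 = (\<Sum>j\<in>{..<m} - J. a j)"
  \<comment> \<open>A case consists of a window i and base exponents e j: frozen if below the
    window, otherwise the start of a progression e j + N s.\<close>
  define X where "X = {(i, e). i \<le> m \<and> e \<in> (J \<rightarrow>\<^sub>E {..<2 * N}) \<and>
    (\<forall>j\<in>J. kk j dvd e j \<and> (e j < i * w \<or> i * w + w \<le> e j \<and> e j < i * w + N))}"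
  define T where "T = (\<lambda>(i, e). {n. \<exists>\<nu>. int D * int n =
     (a0 + (\<Sum>j\<in>{j\<in>J. e j < i * w}. a j * int p ^ e j)) +
     int (p ^ (i * w + w)) * (\<Sum>j\<in>{j\<in>J. \<not> e j < i * w}. int (nat (a j) * p ^ (e j - (i * w + w))) * int q ^ \<nu> j)})"
  have "finite X"
  proof (rule finite_subset)
    show "X \<subseteq> {..m} \<times> (J \<rightarrow>\<^sub>E {..<2 * N})" unfolding X_def by auto
    show "finite ({..m} \<times> (J \<rightarrow>\<^sub>E {..<2 * N}))" using J by (intro finite_cartesian_product finite_PiE) auto
  qed
  have "zero_locus ?B (T x)" if "x \<in> X" for x
  proof -
    obtain i e where x: "x = (i, e)" by (cases x)
    have ie: "i \<le> m" "\<And>j. j \<in> J \<Longrightarrow> e j < i * w \<or> i * w + w \<le> e j \<and> e j < i * w + N"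
      using that unfolding X_def x by auto
    \<comment> \<open>After division by p^(i w + w) the remaining powers are at most p^(N - w), so
      the coefficients add up to at most A p^(N - w) < q / 2.\<close>
    have "(\<Sum>j\<in>{j\<in>J. \<not> e j < i * w}. nat (a j) * p ^ (e j - (i * w + w))) \<le>
       (\<Sum>j\<in>{j\<in>J. \<not> e j < i * w}. nat (a j) * p ^ (N - w))"
    proof (intro sum_mono mult_left_mono power_increasing)
      fix j assume "j \<in> {j\<in>J. \<not> e j < i * w}"
      then show "e j - (i * w + w) \<le> N - w" using ie(2)[of j] by auto
    qed (use p2 in auto)
    also have "\<dots> \<le> (\<Sum>j\<in>J. nat (a j) * p ^ (N - w))" using J by (intro sum_mono2) auto
    also have "\<dots> = A * p ^ (N - w)" by (simp add: A_def sum_distrib_right)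
    finally have "2 * (\<Sum>j\<in>{j\<in>J. \<not> e j < i * w}. nat (a j) * p ^ (e j - (i * w + w))) \<le> 2 * A * p ^ (N - w)"
      by simp
    also have "\<dots> < p ^ w * p ^ (N - w)" using pw p2 by (intro mult_strict_right_mono) auto
    also have "\<dots> = q" using wN unfolding q_def by (simp flip: power_add)
    finally have bound: "2 * (\<Sum>j\<in>{j\<in>J. \<not> e j < i * w}. nat (a j) * p ^ (e j - (i * w + w))) < q" .
    show ?thesis unfolding x T_def prod.case
      by (rule zero_locus_affine_power_sum[OF p _ q_def q3 _ _ bound D])
         (use w wN J p2 in auto)
  qed
  then have "zero_locus ?B (\<Union>(T ` X))"
    using \<open>finite X\<close> const_in_orbit_seqs[of "1 :: 'k poly fract"]
    by (intro zero_locus_Union orbit_seqs_mult) auto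
  have split: "(\<Sum>j<m. a j * int p ^ (kk j * \<nu> j)) = a0 + (\<Sum>j\<in>J. a j * int p ^ (kk j * \<nu> j))" for \<nu>
  proof -
    have "(\<Sum>j\<in>{..<m} - J. a j * int p ^ (kk j * \<nu> j)) = a0"
      unfolding a0_def by (intro sum.cong) (auto simp: J_def)
    then show ?thesis using sum.subset_diff[OF J(2), of "\<lambda>j. a j * int p ^ (kk j * \<nu> j)"] by simp
  qed
  have T_iff: "n \<in> T (i, e) \<longleftrightarrow> (\<exists>s. int D * int n =
      a0 + (\<Sum>j\<in>J. a j * int p ^ (e j + (if e j < i * w then 0 else N * s j))))"
    if X: "(i, e) \<in> X" for n i e
  proof -
    have eq: "int (p ^ (i * w + w)) * (\<Sum>j\<in>{j\<in>J. \<not> e j < i * w}. int (nat (a j) * p ^ (e j - (i * w + w))) * int q ^ s j)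
      = (\<Sum>j\<in>{j\<in>J. \<not> e j < i * w}. a j * int p ^ (e j + N * s j))" for s
      unfolding sum_distrib_left
    proof (intro sum.cong refl)
      fix j assume j: "j \<in> {j\<in>J. \<not> e j < i * w}"
      then have "i * w + w \<le> e j" using X unfolding X_def by auto
      then have "int p ^ (e j + N * s j) = int p ^ (i * w + w) * int p ^ (e j - (i * w + w)) * int q ^ s j"
        by (simp add: q_def flip: power_add power_mult)
      then show "int (p ^ (i * w + w)) * (int (nat (a j) * p ^ (e j - (i * w + w))) * int q ^ s j) =
          a j * int p ^ (e j + N * s j)"
        using J(4)[of j] j by simp
    qed
    have J_split: "(\<Sum>j\<in>J. a j * int p ^ (e j + (if e j < i * w then 0 else N * s j))) =
      (\<Sum>j\<in>{j\<in>J. e j < i * w}. a j * int p ^ e j) + (\<Sum>j\<in>{j\<in>J. \<not> e j < i * w}. a j * int p ^ (e j + N * s j))" for s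
    proof -
      have "J = {j\<in>J. e j < i * w} \<union> {j\<in>J. \<not> e j < i * w}" by auto
      then have "(\<Sum>j\<in>J. a j * int p ^ (e j + (if e j < i * w then 0 else N * s j))) =
        (\<Sum>j\<in>{j\<in>J. e j < i * w} \<union> {j\<in>J. \<not> e j < i * w}. a j * int p ^ (e j + (if e j < i * w then 0 else N * s j)))"
        by simp
      also have "\<dots> = (\<Sum>j\<in>{j\<in>J. e j < i * w}. a j * int p ^ (e j + (if e j < i * w then 0 else N * s j))) +
        (\<Sum>j\<in>{j\<in>J. \<not> e j < i * w}. a j * int p ^ (e j + (if e j < i * w then 0 else N * s j)))"
        using J by (intro sum.union_disjoint) auto
      finally show ?thesis by simp
    qed
    show ?thesis unfolding T_def prod.case mem_Collect_eq eq J_split add.assoc by (rule refl)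
  qed
  have "\<Union>(T ` X) = {n. \<exists>\<nu>. int D * int n = (\<Sum>j<m. a j * int p ^ (kk j * \<nu> j))}"
  proof (intro equalityI subsetI CollectI)
    fix n assume "n \<in> \<Union>(T ` X)"
    then obtain i e where X: "(i, e) \<in> X" "n \<in> T (i, e)" by auto
    then obtain s where s: "int D * int n =
      a0 + (\<Sum>j\<in>J. a j * int p ^ (e j + (if e j < i * w then 0 else N * s j)))" using T_iff by blast
    \<comment> \<open>The division is exact, as \<open>kk j\<close> divides both e j and N.\<close>
    define \<nu> where "\<nu> j = (e j + (if e j < i * w then 0 else N * s j)) div kk j" for j
    have "kk j * \<nu> j = e j + (if e j < i * w then 0 else N * s j)" if "j \<in> J" for j
      unfolding \<nu>_def using X(1) kN[OF that] that by (intro dvd_mult_div_cancel) (auto simp: X_def)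
    then show "\<exists>\<nu>. int D * int n = (\<Sum>j<m. a j * int p ^ (kk j * \<nu> j))"
      unfolding split s by (intro exI[of _ \<nu>]) simp
  next
    fix n assume "n \<in> {n. \<exists>\<nu>. int D * int n = (\<Sum>j<m. a j * int p ^ (kk j * \<nu> j))}"
    then obtain \<nu> where \<nu>: "int D * int n = a0 + (\<Sum>j\<in>J. a j * int p ^ (kk j * \<nu> j))"
      unfolding split by blast
    define E where "E j = kk j * \<nu> j" for j
    have "card ((\<lambda>j. (E j mod N) div w) ` J) \<le> card J" using J by (intro card_image_le)
    also have "\<dots> \<le> m" using card_mono[OF _ J(2)] by simp
    finally have "\<not> {..m} \<subseteq> (\<lambda>j. (E j mod N) div w) ` J"
      using card_mono[of "(\<lambda>j. (E j mod N) div w) ` J" "{..m}"] J by auto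
    then obtain i where i: "i \<le> m" "\<And>j. j \<in> J \<Longrightarrow> (E j mod N) div w \<noteq> i" by auto
    have "(i + 1) * w \<le> (m + 1) * w" using i by (intro mult_right_mono) auto
    then have iN: "(i + 1) * w \<le> N" using Nw by linarith
    have "\<exists>r s. E j = r + (if r < i * w then 0 else N * s) \<and> (r < i * w \<or> i * w + w \<le> r \<and> r < i * w + N)"
      if jJ: "j \<in> J" for j
    proof (cases "E j < i * w")
      case True
      then show ?thesis by (intro exI[of _ "E j"]) auto
    next
      case False
      then obtain r s where "E j = r + N * s" "i * w + w \<le> r" "r < i * w + N"
        using window_decomposition[OF w(1) iN i(2)[OF jJ]] by auto
      then show ?thesis by (intro exI[of _ r] exI[of _ s]) auto
    qed
    then obtain r s where rs: "\<And>j. j \<in> J \<Longrightarrow> E j = r j + (if r j < i * w then 0 else N * s j)"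
      "\<And>j. j \<in> J \<Longrightarrow> r j < i * w \<or> i * w + w \<le> r j \<and> r j < i * w + N" by metis
    define e where "e = restrict r J"
    have eJ: "e j = r j" if "j \<in> J" for j using that by (simp add: e_def)
    have "kk j dvd r j" if "j \<in> J" for j
    proof -
      have "kk j dvd E j" by (simp add: E_def)
      then have "kk j dvd r j + (if r j < i * w then 0 else N * s j)" using rs(1)[OF that] by simp
      then show ?thesis using kN[OF that] by (auto simp: dvd_add_left_iff split: if_splits)
    qed
    moreover have "r j < 2 * N" if "j \<in> J" for j using rs(2)[OF that] iN w by auto
    ultimately have X: "(i, e) \<in> X"
      using i rs(2) eJ unfolding X_def by (auto simp: e_def)
    have "int D * int n = a0 + (\<Sum>j\<in>J. a j * int p ^ E j)" using \<nu> by (simp add: E_def)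
    also have "(\<Sum>j\<in>J. a j * int p ^ E j) =
      (\<Sum>j\<in>J. a j * int p ^ (e j + (if e j < i * w then 0 else N * s j)))"
      using rs(1) eJ by (intro sum.cong refl) simp
    finally have "n \<in> T (i, e)" unfolding T_iff[OF X] by (intro exI[of _ s])
    then show "n \<in> \<Union>(T ` X)" using X by blast
  qed
  then show ?thesis using \<open>zero_locus ?B (\<Union>(T ` X))\<close> by simp
qed

section \<open>From rational to integer coefficients, and the two kinds of sets\<close>

lemma common_denominator:
  fixes c :: "nat \<Rightarrow> rat"
  shows "\<exists>D>0. \<exists>a. \<forall>j<m. of_nat D * c j = of_int (a j)"
proof (induction m)
  case 0
  show ?case by (intro exI[of _ 1]) auto
next
  case (Suc m)
  then obtain D a where D: "D > 0" "\<forall>j<m. of_nat D * c j = of_int (a j)" by blast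
  obtain u v where uv: "c m = of_int u / of_int v" "v > 0"
    using quotient_of_div quotient_of_denom_pos by (metis surj_pair)
  define a' where "a' j = (if j = m then int D * u else v * a j)" for j
  have "of_nat (D * nat v) * c j = of_int (a' j)" if "j < Suc m" for j
  proof (cases "j = m")
    case True
    then show ?thesis using uv by (simp add: a'_def)
  next
    case False
    then have "of_nat D * c j = of_int (a j)" using D that by simp
    then show ?thesis using uv False by (simp add: a'_def mult_ac)
  qed
  then show ?case using D(1) uv(2) by (intro exI[of _ "D * nat v"] conjI exI[of _ a']) auto
qed

text \<open>With n_j large and all other n_i = 0, the term c_j p^(k_j n_j) dominates, so a negative
  c_j would produce a negative element.\<close>

lemma Bset_nonneg_imp_coeff_pos:
  assumes "p \<ge> 2" "\<And>x. x \<in> Bset p m c kk \<Longrightarrow> x \<ge> 0" "j < m" "kk j > 0" "c j \<noteq> 0"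
  shows "c j > 0"
proof (rule ccontr)
  assume "\<not> c j > 0"
  then have neg: "c j < 0" using assms by simp
  define R where "R = (\<Sum>i\<in>{..<m} - {j}. c i)"
  \<comment> \<open>This s suffices as the exponent because s <= p^(k_j s).\<close>
  obtain s where s: "R / (- c j) < of_nat s" using reals_Archimedean2 by blast
  define n where "n i = (if i = j then s else 0)" for i
  have "(\<Sum>i<m. c i * of_nat p ^ (kk i * n i)) =
     c j * of_nat p ^ (kk j * n j) + (\<Sum>i\<in>{..<m} - {j}. c i * of_nat p ^ (kk i * n i))"
    using assms by (simp add: sum.remove)
  also have "(\<Sum>i\<in>{..<m} - {j}. c i * of_nat p ^ (kk i * n i)) = R"
    unfolding R_def by (intro sum.cong) (auto simp: n_def)
  finally have sum: "(\<Sum>i<m. c i * of_nat p ^ (kk i * n i)) = c j * of_nat p ^ (kk j * s) + R"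
    by (simp add: n_def)
  have "s \<le> 2 ^ s" by (simp add: less_imp_le)
  also have "(2::nat) ^ s \<le> p ^ s" using assms by (intro power_mono) auto
  also have "\<dots> \<le> p ^ (kk j * s)" using assms by (intro power_increasing) auto
  finally have "(of_nat s :: rat) \<le> of_nat (p ^ (kk j * s))" by (simp only: of_nat_le_iff)
  with s have "R / (- c j) < of_nat (p ^ (kk j * s))" by (rule less_le_trans)
  then have "R / (- c j) < of_nat p ^ (kk j * s)" unfolding of_nat_power .
  then have "R < of_nat p ^ (kk j * s) * (- c j)" using neg by (subst (asm) pos_divide_less_eq) auto
  then have "(\<Sum>i<m. c i * of_nat p ^ (kk i * n i)) < 0" unfolding sum by (simp add: mult.commute)
  moreover have "(\<Sum>i<m. c i * of_nat p ^ (kk i * n i)) \<in> Bset p m c kk" unfolding Bset_def by blast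
  ultimately show False using assms(2) by fastforce
qed

text \<open>As A consists of natural numbers, the terms with k_j > 0 have positive coefficients.
  Multiplication by a common denominator D gives the integer form.\<close>

lemma zero_locus_p_set:
  assumes p: "prime p" "CHAR('k::alg_closed_field) = p" and "p_set p A"
  shows "zero_locus (orbit_seqs :: (nat \<Rightarrow> 'k poly fract) set) A"
proof -
  from assms(3) obtain m c kk where c: "\<And>j. j < m \<Longrightarrow> c j \<noteq> 0"
    and A: "(of_nat ` A :: rat set) = Bset p m c kk"
    unfolding p_set_def by blast
  obtain D a where D: "D > 0" "\<And>j. j < m \<Longrightarrow> of_nat D * c j = of_int (a j)"
    using common_denominator[of m c] by blast
  have pos: "a j > 0" if "j < m" "kk j > 0" for j
  proof -
    have "x \<ge> 0" if "x \<in> Bset p m c kk" for x using that by (auto simp flip: A)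
    from Bset_nonneg_imp_coeff_pos[of p m c kk j, OF prime_ge_2_nat[OF p(1)] this that c[OF that(1)]]
    have "c j > 0" by simp
    then have "(0 :: rat) < of_nat D * c j" using D(1) by simp
    then show ?thesis unfolding D(2)[OF that(1)] by simp
  qed
  have "A = {n. \<exists>\<nu>. int D * int n = (\<Sum>j<m. a j * int p ^ (kk j * \<nu> j))}"
  proof (intro set_eqI)
    fix n
    have "n \<in> A \<longleftrightarrow> (of_nat n :: rat) \<in> of_nat ` A" by auto
    also have "\<dots> \<longleftrightarrow> (\<exists>\<nu>. (of_nat n :: rat) = (\<Sum>j<m. c j * of_nat p ^ (kk j * \<nu> j)))"
      unfolding A Bset_def by auto
    also have "\<dots> \<longleftrightarrow> (\<exists>\<nu>. int D * int n = (\<Sum>j<m. a j * int p ^ (kk j * \<nu> j)))"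
    proof (intro iff_exI)
      fix \<nu>
      have "(of_nat n :: rat) = (\<Sum>j<m. c j * of_nat p ^ (kk j * \<nu> j)) \<longleftrightarrow>
        of_nat D * of_nat n = of_nat D * (\<Sum>j<m. c j * of_nat p ^ (kk j * \<nu> j))" using D(1) by simp
      also have "of_nat D * (\<Sum>j<m. c j * of_nat p ^ (kk j * \<nu> j)) =
        (\<Sum>j<m. of_int (a j) * of_nat p ^ (kk j * \<nu> j))"
        unfolding sum_distrib_left by (intro sum.cong refl) (simp add: D(2)[symmetric] mult.assoc)
      also have "\<dots> = of_int (\<Sum>j<m. a j * int p ^ (kk j * \<nu> j))" by simp
      also have "(of_nat D :: rat) * of_nat n = of_int (int D * int n)" by simp
      finally show "(of_nat n :: rat) = (\<Sum>j<m. c j * of_nat p ^ (kk j * \<nu> j)) \<longleftrightarrow>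
        int D * int n = (\<Sum>j<m. a j * int p ^ (kk j * \<nu> j))" unfolding of_int_eq_iff .
    qed
    finally show "n \<in> A \<longleftrightarrow> n \<in> {n. \<exists>\<nu>. int D * int n = (\<Sum>j<m. a j * int p ^ (kk j * \<nu> j))}" by simp
  qed
  then show ?thesis using zero_locus_int_power_sum[OF p D(1) pos] by simp
qed

lemma zero_locus_arith_prog:
  assumes "arith_prog A"
  shows "zero_locus (orbit_seqs :: (nat \<Rightarrow> 'k::field poly fract) set) A"
proof -
  from assms obtain a b where A: "A = {a + b * t | t. True}" unfolding arith_prog_def by blast
  \<comment> \<open>For b = 0 the set is {a}, which has period 1 only beyond a; hence the threshold
    a + 1.\<close>
  have per: "n + (if b = 0 then 1 else b) \<in> A \<longleftrightarrow> n \<in> A" if "n \<ge> a + 1" for n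
  proof (cases "b = 0")
    case True
    then show ?thesis using that unfolding A by auto
  next
    case False
    have "n + b \<in> A \<longleftrightarrow> n \<in> A"
    proof
      assume "n + b \<in> A"
      then obtain t where t: "n + b = a + b * t" unfolding A by auto
      then have "t \<noteq> 0" using that False by (intro notI) simp
      then obtain s where "t = Suc s" using not0_implies_Suc by blast
      then have "n = a + b * s" using t by simp
      then show "n \<in> A" unfolding A by auto
    next
      assume "n \<in> A"
      then obtain t where "n = a + b * t" unfolding A by auto
      then have "n + b = a + b * Suc t" by simp
      then show "n + b \<in> A" unfolding A by blast
    qed
    then show ?thesis using False by simp
  qed
  show ?thesis
    by (rule zero_locus_eventually_periodic[OF _ per var_fract_neq]) auto
qed

theorem theorem1p6:
  fixes p :: nat and S :: "nat set"
  assumes "prime p"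
    and "is_alg_closure_Fp p TYPE('k::alg_closed_field)"
    and "\<exists>\<A>. finite \<A> \<and> (\<forall>A\<in>\<A>. arith_prog A \<or> p_set p A) \<and> S = \<Union>\<A>"
  shows "\<exists>(k::nat) (\<Phi> :: (nat \<Rightarrow> 'k poly fract) \<Rightarrow> (nat \<Rightarrow> 'k poly fract)) \<alpha> F.
           k \<ge> 1 \<and> torus_endo k \<Phi> \<and> \<alpha> \<in> torus k \<and> closed_subvariety k F \<and>
           {n. (\<Phi> ^^ n) \<alpha> \<in> zero_set k F} = S"
proof (rule torus_realization)
  have p: "CHAR('k) = p" using assms(2) by (simp add: is_alg_closure_Fp_def)
  obtain \<A> where \<A>: "finite \<A>" "\<And>A. A \<in> \<A> \<Longrightarrow> arith_prog A \<or> p_set p A" "S = \<Union>\<A>"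
    using assms(3) by blast
  show "zero_locus (orbit_seqs :: (nat \<Rightarrow> 'k poly fract) set) S"
    unfolding \<A>(3)
  proof (rule zero_locus_Union[OF orbit_seqs_mult _ \<A>(1)])
    show "(\<lambda>_. 1 :: 'k poly fract) \<in> orbit_seqs" by (rule const_in_orbit_seqs) simp
    fix A assume "A \<in> \<A>"
    then show "zero_locus (orbit_seqs :: (nat \<Rightarrow> 'k poly fract) set) A"
      using \<A>(2) zero_locus_arith_prog zero_locus_p_set[OF assms(1) p] by blast
  qed
qed

end
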